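(* Let $t\ge 1$ be an integer, let $a_1,\dots,a_t$ be positive integers and let $b_1\ge b_2\ge\cdots\ge b_t\ge 1$ be integers. Put $a=\sum_{s=1}^t a_s$ and $b=\sum_{s=1}^t b_s-t+1$. Let $G$ be a size Ramsey minimal graph for $(a_1K_{1,b_1},a_2K_{1,b_2},\dots,a_tK_{1,b_t})$. Then (up to isomorphism) $G=(a-t+1)K_{1,b}$, or one of the following exceptional alternatives occurs: (1) $a_1=1$, $b_1=2$ and $b_s=1$ for all $2\le s\le t$, and $G=cC_4\sqcup(a-t+1-2c)K_{1,2}$ for some integer $c$ with $1\le c\le\lfloor (a-t+1)/2\rfloor$; (2) $t\ge 2$, $b_1=b_2=2$ and $b_s=1$ for all $3\le s\le t$, and either (2a) $G=cK_3\sqcup(a-t+1-c)K_{1,3}$ for some integer $c$ with $1\le c\le a-t+1$; or (2b) $a_1=a_2=1$ and $G=cK_3\sqcup c'K_4\sqcup(a-t+1-c-2c')K_{1,3}$ for some nonnegative integers $c,c'$ with $1\le c+2c'\le a-t+1$.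
   Context: All graphs are finite and simple, and isolated vertices are ignored (graphs are identified up to isomorphism and up to adding or deleting isolated vertices). $e(G)$ is the number of edges of $G$. $K_{1,n}$ is the star with $n$ edges, $K_n$ the complete graph on $n$ vertices, $C_n$ the cycle on $n$ vertices. $G\sqcup H$ is the vertex-disjoint union, and $mH$ is the vertex-disjoint union of $m$ copies of $H$ (empty if $m=0$). For graphs $G,G_1,\dots,G_t$, write $G\rightarrow(G_1,\dots,G_t)$ if every coloring of $E(G)$ with colors $1,\dots,t$ contains, for some $i\in\{1,\dots,t\}$, a copy of $G_i$ (as a not necessarily induced subgraph) all of whose edges have color $i$. The size Ramsey number is $\hat r(G_1,\dots,G_t)=\min\{e(G): G\rightarrow(G_1,\dots,G_t)\}$. A graph $G$ is a size Ramsey minimal graph for $(G_1,\dots,G_t)$ if $G\rightarrow(G_1,\dots,G_t)$ and $e(G)=\hat r(G_1,\dots,G_t)$. *)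

theory Defs
  imports Main "HOL-Library.Ramsey"
begin

text \<open>
  Graphs are taken up to adding or deleting isolated vertices, so a graph is represented by its
  set of edges, an edge being a two-element set of vertices.  The (non-isolated) vertices of
  \<open>G\<close> are \<open>\<Union>G\<close>, and the number of edges is \<open>card G\<close>.
\<close>

type_synonym 'v graph = "'v set set"

definition finite_simple_graph :: "'v graph \<Rightarrow> bool" where
  "finite_simple_graph G \<longleftrightarrow> finite G \<and> (\<forall>e\<in>G. card e = 2)"

definition graph_iso :: "'v graph \<Rightarrow> 'w graph \<Rightarrow> bool" (infix \<open>\<simeq>\<^sub>g\<close> 50) where
  "G \<simeq>\<^sub>g H \<longleftrightarrow> (\<exists>\<phi>. bij_betw \<phi> (\<Union>G) (\<Union>H) \<and> (\<lambda>e. \<phi> ` e) ` G = H)"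

definition star_graph :: "nat \<Rightarrow> nat graph" where
  "star_graph n = {{0, i} | i. i \<in> {1..n}}"

definition complete_graph :: "nat \<Rightarrow> nat graph" where
  "complete_graph n = [{..<n}]\<^bsup>2\<^esup>"

text \<open>The next definition is the cycle on \<open>n\<close> vertices only for \<open>n \<ge> 3\<close>.\<close>

definition cycle_graph :: "nat \<Rightarrow> nat graph" where
  "cycle_graph n = {{i, (i + 1) mod n} | i. i < n}"

definition disj_union :: "'v graph \<Rightarrow> 'w graph \<Rightarrow> ('v + 'w) graph" (infixr \<open>\<squnion>\<^sub>g\<close> 65) where
  "G \<squnion>\<^sub>g H = (\<lambda>e. Inl ` e) ` G \<union> (\<lambda>e. Inr ` e) ` H"

definition copies :: "nat \<Rightarrow> 'v graph \<Rightarrow> (nat \<times> 'v) graph" where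
  "copies m H = (\<Union>j<m. (\<lambda>e. Pair j ` e) ` H)"

definition contains_copy :: "'v graph \<Rightarrow> 'w graph \<Rightarrow> bool" where
  "contains_copy F H \<longleftrightarrow> (\<exists>F'\<subseteq>F. H \<simeq>\<^sub>g F')"

text \<open>\<open>arrows t G H\<close> is \<open>G \<rightarrow> (H 1, \<dots>, H t)\<close>; values of \<open>H\<close> outside \<open>{1..t}\<close> are
  irrelevant.\<close>

definition arrows :: "nat \<Rightarrow> 'v graph \<Rightarrow> (nat \<Rightarrow> 'w graph) \<Rightarrow> bool" where
  "arrows t G H \<longleftrightarrow>
     (\<forall>f. f ` G \<subseteq> {1..t} \<longrightarrow> (\<exists>i\<in>{1..t}. contains_copy {e \<in> G. f e = i} (H i)))"

text \<open>Every finite graph is isomorphic to one with vertices in \<open>nat\<close>, so the minimum over such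
  graphs is the minimum over all finite graphs.\<close>

definition size_ramsey :: "nat \<Rightarrow> (nat \<Rightarrow> 'w graph) \<Rightarrow> nat" where
  "size_ramsey t H =
     (LEAST m. \<exists>G :: nat graph. finite_simple_graph G \<and> arrows t G H \<and> card G = m)"

definition size_ramsey_minimal :: "nat \<Rightarrow> 'v graph \<Rightarrow> (nat \<Rightarrow> 'w graph) \<Rightarrow> bool" where
  "size_ramsey_minimal t G H \<longleftrightarrow>
     finite_simple_graph G \<and> arrows t G H \<and> card G = size_ramsey t H"

end

theory Submission
  imports Defs "HOL-Combinatorics.Transposition" "HOL-Library.Disjoint_Sets"
begin

text \<open>
  Write \<open>n = A - t + 1\<close> and \<open>D = B - 1\<close>.  A graph is good if its edges can be coloured so that
  every vertex has fewer than \<open>b s\<close> edges of colour \<open>s\<close>; a proper edge colouring with \<open>D\<close> colours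
  suffices for this.  If deleting \<open>n - 1\<close> vertices makes \<open>G\<close> good, then \<open>G\<close> does not arrow: distribute
  the deleted vertices over the colours, \<open>a s - 1\<close> of them to colour \<open>s\<close>, and give every edge at a
  deleted vertex the colour of that vertex.

  A graph that cannot be made good in this way has at least \<open>n B\<close> edges.  Vertices of degree at least
  \<open>B\<close> are deleted first.  When the maximum degree is at most \<open>D\<close>, the extension lemma behind
  Vizing's theorem (a vertex can be added to a properly \<open>D\<close>-coloured graph if all degrees are at most
  \<open>D\<close> and at most one of its neighbours has degree \<open>D\<close>) shows that a bad graph has a vertex of degree
  \<open>D\<close> with two neighbours of degree \<open>D\<close>; deleting such vertices one at a time gives at least \<open>3 n\<close>
  vertices of degree \<open>D\<close>, hence at least \<open>3 n D / 2 \<ge> n B\<close> edges, with equality only for \<open>D = 2\<close>.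

  In the case of equality, induct on \<open>n\<close>: if the maximum degree is at most \<open>D\<close> there is a triangle
  component; otherwise all vertices of degree at least \<open>B\<close> have degree exactly \<open>B\<close>, and deleting any
  of them leaves a graph of known structure.  Comparing these structures for different deleted
  vertices leaves only components \<open>K\<^bsub>1,B\<^esub>\<close>, \<open>C\<^sub>4\<close>, \<open>K\<^sub>3\<close> and \<open>K\<^sub>4\<close>.  Finally, a component on four vertices
  contains no two disjoint copies of \<open>K\<^bsub>1,2\<^esub>\<close>, so it can be given a single colour \<open>s\<close> with \<open>b s = 2\<close> at
  the cost of one star instead of two deleted vertices; this forces \<open>a s = 1\<close>.
\<close>

section \<open>Recolouring along alternating paths\<close>

definition proper_colouring :: "'v graph \<Rightarrow> 'c set \<Rightarrow> ('v set \<Rightarrow> 'c) \<Rightarrow> bool" where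
  "proper_colouring F C f \<longleftrightarrow>
     f ` F \<subseteq> C \<and> (\<forall>e\<in>F. \<forall>e'\<in>F. e \<noteq> e' \<longrightarrow> e \<inter> e' \<noteq> {} \<longrightarrow> f e \<noteq> f e')"

definition misses :: "'v graph \<Rightarrow> ('v set \<Rightarrow> 'c) \<Rightarrow> 'v \<Rightarrow> 'c \<Rightarrow> bool" where
  "misses F f v k \<longleftrightarrow> (\<forall>e\<in>F. v \<in> e \<longrightarrow> f e \<noteq> k)"

text \<open>
  The set \<open>S\<close> is the alternating path \<open>w, \<tau> w, \<sigma> (\<tau> w), \<dots>\<close>, possibly infinite; only its ends can be
  fixed points.  With \<open>\<sigma>\<close> and \<open>\<tau>\<close> the partner maps of two colours this is a Kempe chain.
\<close>

lemma involutions_path: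
  assumes s: "\<And>x. \<sigma> (\<sigma> x) = x" and t: "\<And>x. \<tau> (\<tau> x) = x" and w: "\<sigma> w = w"
  shows "\<exists>S z. w \<in> S \<and> \<sigma> ` S \<subseteq> S \<and> \<tau> ` S \<subseteq> S \<and> (\<forall>x\<in>S. \<sigma> x = x \<or> \<tau> x = x \<longrightarrow> x = w \<or> x = z)"
proof -
  \<comment> \<open>The walk applies \<open>\<tau>\<close> at even steps and \<open>\<sigma>\<close>
    at odd steps, beginning with \<open>\<tau>\<close> because \<open>w\<close> is already fixed by
    \<open>\<sigma>\<close>.\<close>
  define p where "p = rec_nat w (\<lambda>k x. if even k then \<tau> x else \<sigma> x)"
  have p0: "p 0 = w" and pS: "p (Suc k) = (if even k then \<tau> (p k) else \<sigma> (p k))" for k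
    by (auto simp: p_def)
  have tau: "\<tau> (p k) = (if even k then p (Suc k) else p (k - 1))" for k
    by (cases k) (auto simp: pS p0 t)
  have sig: "\<sigma> (p k) = (if odd k then p (Suc k) else if k = 0 then p 0 else p (k - 1))" for k
    by (cases k) (auto simp: pS p0 w s)
  show ?thesis
  proof (cases "\<exists>m. p (Suc m) = p m")
    case True
    \<comment> \<open>The first stationary step is the far end of the path and supplies
      \<open>z\<close>. If no step is stationary, the only end is \<open>w\<close>, and
      \<open>z\<close> is set to \<open>w\<close> as a dummy.\<close>
    define m where "m = (LEAST m. p (Suc m) = p m)"
    have m: "p (Suc m) = p m" unfolding m_def using True by (rule LeastI_ex)
    have least: "p (Suc k) \<noteq> p k" if "k < m" for k
      using not_less_Least that unfolding m_def by blast
    have "\<sigma> (p k) \<in> p ` {..m}" if "k \<le> m" for k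
      using that m by (cases "k = m") (auto simp: sig)
    moreover have "\<tau> (p k) \<in> p ` {..m}" if "k \<le> m" for k
      using that m by (cases "k = m") (auto simp: tau)
    moreover have "p k = w \<or> p k = p m" if k: "k \<le> m" and f: "\<sigma> (p k) = p k \<or> \<tau> (p k) = p k" for k
    proof (rule ccontr)
      assume n: "\<not> ?thesis"
      then have "k \<noteq> 0" "k < m" using p0 k by (auto simp: le_less intro!: gr0I)
      moreover have "p k \<noteq> p (k - 1)" using least[of "k - 1"] \<open>k \<noteq> 0\<close> \<open>k < m\<close> by auto
      moreover have "p (Suc k) \<noteq> p k" using least \<open>k < m\<close> by auto
      ultimately show False using f by (auto simp: sig tau split: if_splits)
    qed
    ultimately show ?thesis
      by (intro exI[of _ "p ` {..m}"] exI[of _ "p m"]) (use p0 in \<open>auto intro: image_eqI[of w p 0]\<close>)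
  next
    case False
    have "p k = w" if f: "\<sigma> (p k) = p k \<or> \<tau> (p k) = p k" for k
    proof (rule ccontr)
      assume n: "\<not> ?thesis"
      then have "k \<noteq> 0" using p0 by (cases k) auto
      then have "p k \<noteq> p (k - 1)" using False by (metis Suc_pred' bot_nat_0.not_eq_extremum)
      then show False using f False \<open>k \<noteq> 0\<close> by (auto simp: sig tau split: if_splits) 
    qed
    moreover have "w \<in> range p" using p0 by (metis rangeI)
    ultimately show ?thesis
      by (intro exI[of _ "range p"] exI[of _ w]) (auto simp: sig tau)
  qed
qed

text \<open>Sending a vertex that misses \<open>k\<close> to itself makes this a total involution
  for a proper colouring, whose fixed points are exactly the vertices missing \<open>k\<close>.
  Alternating paths can then be treated through \<open>involutions_path\<close>.\<close>

definition mate :: "'v graph \<Rightarrow> ('v set \<Rightarrow> 'c) \<Rightarrow> 'c \<Rightarrow> 'v \<Rightarrow> 'v" where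
  "mate F f k v = (if misses F f v k then v else SOME u. {v, u} \<in> F \<and> f {v, u} = k)"

lemma simple_edgeE:
  assumes "finite_simple_graph F" "e \<in> F" "v \<in> e"
  obtains u where "u \<noteq> v" "e = {v, u}"
proof -
  have "card e = 2" using assms by (auto simp: finite_simple_graph_def)
  then obtain x y where "e = {x, y}" "x \<noteq> y" by (auto simp: card_2_iff)
  then show ?thesis using that[of x] that[of y] assms(3) by (auto simp: insert_commute)
qed

lemma mate_edge:
  assumes "finite_simple_graph F" "proper_colouring F C f" "e \<in> F" "v \<in> e"
  shows "e = {v, mate F f (f e) v}" and "mate F f (f e) v \<noteq> v"
proof -
  obtain u where u: "u \<noteq> v" "e = {v, u}" using simple_edgeE assms by metis
  have m: "\<not> misses F f v (f e)" using assms by (auto simp: misses_def)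
  have "(SOME w. {v, w} \<in> F \<and> f {v, w} = f e) = u"
  proof (rule some_equality)
    show "{v, u} \<in> F \<and> f {v, u} = f e" using u assms by auto
    show "w = u" if "{v, w} \<in> F \<and> f {v, w} = f e" for w
    proof -
      have "{v, w} = e"
        using that assms(2-4) unfolding proper_colouring_def by (metis disjoint_iff insertI1)
      then show ?thesis using u by (auto simp: doubleton_eq_iff)
    qed
  qed
  then show "e = {v, mate F f (f e) v}" "mate F f (f e) v \<noteq> v" using m u by (auto simp: mate_def)
qed

lemma mate_involution:
  assumes "finite_simple_graph F" "proper_colouring F C f"
  shows "mate F f k (mate F f k v) = v"
proof (cases "misses F f v k")
  case False
  then obtain e where e: "e \<in> F" "v \<in> e" "f e = k" by (auto simp: misses_def)
  define u where "u = mate F f k v"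
  have "e = {v, u}" "u \<noteq> v" using mate_edge[OF assms e(1,2)] e by (auto simp: u_def)
  moreover have "e = {u, mate F f k u}" "mate F f k u \<noteq> u"
    using mate_edge[OF assms e(1), of u] e \<open>e = {v, u}\<close> by auto
  ultimately show ?thesis by (auto simp: u_def doubleton_eq_iff)
qed (simp add: mate_def)

text \<open>The hypothesis on \<open>S\<close> says that it is a union of Kempe chains of the
  colours \<open>i\<close> and \<open>j\<close>. Edges of other colours may cross the boundary of
  \<open>S\<close>, but the transposition fixes their colours, so at each vertex all incident edges
  are recoloured by the same permutation.\<close>

lemma proper_switch:
  assumes p: "proper_colouring F C f" and ij: "i \<in> C" "j \<in> C"
    and cl: "\<And>e. e \<in> F \<Longrightarrow> f e = i \<or> f e = j \<Longrightarrow> e \<inter> S \<noteq> {} \<Longrightarrow> e \<subseteq> S"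
  defines "f' \<equiv> \<lambda>e. if e \<inter> S \<noteq> {} then transpose i j (f e) else f e"
  shows "proper_colouring F C f'"
    and "misses F f' v k \<longleftrightarrow> misses F f v (if v \<in> S then transpose i j k else k)"
proof -
  have val: "f' e = (if v \<in> S then transpose i j (f e) else f e)" if "e \<in> F" "v \<in> e" for e v
    using cl[OF that(1)] that(2) by (auto simp: f'_def transpose_def)
  have "f' e \<in> C" if "e \<in> F" for e
    using p ij that by (auto simp: f'_def transpose_def proper_colouring_def)
  moreover have "f' e \<noteq> f' e'" if e: "e \<in> F" "e' \<in> F" "e \<noteq> e'" "e \<inter> e' \<noteq> {}" for e e'
  proof -
    obtain v where "v \<in> e" "v \<in> e'" using e by auto
    moreover have "f e \<noteq> f e'" using p e by (auto simp: proper_colouring_def)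
    ultimately show ?thesis using e val by (auto simp: transpose_eq_iff) 
  qed
  ultimately show "proper_colouring F C f'" by (auto simp: proper_colouring_def)
  show "misses F f' v k \<longleftrightarrow> misses F f v (if v \<in> S then transpose i j k else k)"
    using val[of _ v] by (auto simp: misses_def transpose_eq_iff)
qed

text \<open>
  Here \<open>N\<close> is the neighbourhood of a vertex outside \<open>F\<close>, and \<open>M u\<close> is a set of colours missing at \<open>u\<close>.
  Among all choices with \<open>card (M u) = 2\<close>, except \<open>card (M x) = 1\<close> for one \<open>x\<close>, minimise the sum of
  squares of the sizes of \<open>X k = {u. k \<in> M u}\<close>: a Kempe switch would decrease it if two sizes differed
  by more than \<open>2\<close>, so by parity some \<open>X k\<close> is a singleton \<open>{u}\<close>.  Give \<open>k\<close> to \<open>u\<close> and recurse without the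
  colour class \<open>k\<close>.
\<close>

lemma fan_recolouring:
  fixes F :: "'v graph" and C :: "'c set"
  assumes "finite N" "finite C" "finite_simple_graph F" "proper_colouring F C f" "card N \<le> card C"
    and "\<And>u. u \<in> N \<Longrightarrow> finite (M u) \<and> M u \<subseteq> C \<and> (\<forall>k\<in>M u. misses F f u k)"
    and "\<And>u. u \<in> N \<Longrightarrow> card (M u) \<ge> 1" "\<And>u. u \<in> N \<Longrightarrow> u \<noteq> u0 \<Longrightarrow> card (M u) \<ge> 2"
  shows "\<exists>f' g. proper_colouring F C f' \<and> inj_on g N \<and> g ` N \<subseteq> C \<and> (\<forall>u\<in>N. misses F f' u (g u))"
  using assms
proof (induction "card N" arbitrary: N C F f M u0)
  case 0
  then show ?case by auto
next
  case (Suc n)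
  note fs = Suc.prems(3)
  have "N \<noteq> {}" using Suc.hyps by auto
  \<comment> \<open>One vertex keeps a single missing colour even if \<open>u0\<close> lies outside
    \<open>N\<close>; this is what makes the total number of pairs odd.\<close>
  define x where "x = (if u0 \<in> N then u0 else SOME u. u \<in> N)"
  have x: "x \<in> N" using \<open>N \<noteq> {}\<close> by (auto simp: x_def some_in_eq)
  define size' where "size' u = (if u = x then 1 else 2 :: nat)" for u
  define valid where "valid f M \<longleftrightarrow> proper_colouring F C f \<and>
     (\<forall>u\<in>N. M u \<subseteq> C \<and> (\<forall>k\<in>M u. misses F f u k) \<and> card (M u) = size' u)" for f M
  have "\<exists>S\<subseteq>M u. card S = size' u" if "u \<in> N" for u
  proof -
    have "size' u \<le> card (M u)" using Suc.prems(7,8)[OF that] that by (auto simp: size'_def x_def)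
    then show ?thesis by (metis obtain_subset_with_card_n)
  qed
  then obtain M1 where "\<And>u. u \<in> N \<Longrightarrow> M1 u \<subseteq> M u \<and> card (M1 u) = size' u" by metis
  then have v1: "valid f M1"
    using Suc.prems(4,6) unfolding valid_def by blast
  define X where "X M k = {u \<in> N. k \<in> M u}" for M :: "'v \<Rightarrow> 'c set" and k
  define \<Phi> where "\<Phi> M = (\<Sum>k\<in>C. (card (X M k))\<^sup>2)" for M
  obtain f M where v: "valid f M" and min: "\<And>f' M'. valid f' M' \<Longrightarrow> \<Phi> M \<le> \<Phi> M'"
    using ex_has_least_nat[of "\<lambda>(f, M). valid f M" "(f, M1)" "\<lambda>(f, M). \<Phi> M"] v1 by auto
  have pf: "proper_colouring F C f" and
    Mv: "\<And>u. u \<in> N \<Longrightarrow> M u \<subseteq> C \<and> (\<forall>k\<in>M u. misses F f u k) \<and> card (M u) = size' u"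
    using v by (auto simp: valid_def)
  have fX: "finite (X M k)" for M k using Suc.prems(1) by (auto simp: X_def)
  have "(\<Sum>k\<in>C. card (X M k)) = (\<Sum>u\<in>N. card {k \<in> C. k \<in> M u})"
    unfolding X_def using sum_multicount_gen[of N C "\<lambda>u k. k \<in> M u" "\<lambda>k. card {u \<in> N. k \<in> M u}"] Suc.prems(1,2) by simp
  also have "\<dots> = (\<Sum>u\<in>N. size' u)"
  proof (rule sum.cong)
    show "card {k \<in> C. k \<in> M u} = size' u" if "u \<in> N" for u
      using Mv[OF that] by (metis Collect_mem_eq Collect_conj_eq Int_absorb1)
  qed simp
  also have "\<dots> = 1 + 2 * n"
    using x Suc.hyps(2) Suc.prems(1) by (simp add: sum.remove[OF _ x] size'_def)
  finally have tot: "(\<Sum>k\<in>C. card (X M k)) = 1 + 2 * n" .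
  have "\<exists>k\<in>C. card (X M k) = 1"
  proof (rule ccontr)
    assume no: "\<not> ?thesis"
    \<comment> \<open>The total 1 + 2n is below 2 \<open>card C\<close>, so some class has fewer
      than two elements and is therefore empty. As the total is odd, some class also has odd size,
      hence size at least 3.\<close>
    have "\<exists>j\<in>C. card (X M j) < 2"
    proof (rule ccontr)
      assume "\<not> ?thesis"
      then have "(\<Sum>k\<in>C. card (X M k)) \<ge> (\<Sum>k\<in>C. 2)" by (intro sum_mono) auto
      then show False using tot Suc.hyps(2) Suc.prems(5) by simp
    qed
    then obtain j where j: "j \<in> C" "card (X M j) = 0" using no by force
    have "odd (\<Sum>k\<in>C. card (X M k))" using tot by simp
    then obtain i where i: "i \<in> C" "odd (card (X M i))" by (metis dvd_sum)
    then have i3: "card (X M i) \<ge> 3" using no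
      by (metis One_nat_def dvd_triv_left even_numeral Suc_leI le_neq_implies_less less_Suc_eq_le not_less_eq_eq numeral_2_eq_2 numeral_3_eq_3 odd_pos)
    have ij: "i \<noteq> j" using i j by auto
    have Xj: "X M j = {}" using j fX by auto
    then obtain w where w: "w \<in> X M i" using i3 by fastforce
    then have "misses F f w i" using Mv by (auto simp: X_def)
    then have mw: "mate F f i w = w" by (simp add: mate_def)
    note inv = mate_involution[OF fs pf]
    obtain S z where S: "w \<in> S" "mate F f i ` S \<subseteq> S" "mate F f j ` S \<subseteq> S"
      and Sz: "\<And>u. u \<in> S \<Longrightarrow> mate F f i u = u \<or> mate F f j u = u \<Longrightarrow> u = w \<or> u = z"
      using involutions_path[of "mate F f i" "mate F f j" w, OF inv inv mw] by metis
    have cl: "e \<subseteq> S" if e: "e \<in> F" "f e = i \<or> f e = j" "e \<inter> S \<noteq> {}" for e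
    proof -
      obtain u where u: "u \<in> e" "u \<in> S" using e by auto
      then have "e = {u, mate F f (f e) u}" using mate_edge[OF fs pf e(1)] by auto
      then show ?thesis using u S e by auto
    qed
    define f' where "f' = (\<lambda>e. if e \<inter> S \<noteq> {} then transpose i j (f e) else f e)"
    define M' where "M' u = (if u \<in> S then transpose i j ` M u else M u)" for u
    note sw = proper_switch[OF pf i(1) j(1), of S, OF cl, folded f'_def]
    have "valid f' M'"
      unfolding valid_def
    proof (intro conjI ballI)
      show "proper_colouring F C f'" using sw(1) by blast
      fix u assume u: "u \<in> N"
      show "M' u \<subseteq> C" using Mv[OF u] i j by (auto simp: M'_def transpose_def)
      show "card (M' u) = size' u" 
        using Mv[OF u] card_image[of "transpose i j" "M u"]
        by (auto simp: M'_def intro!: inj_on_inverseI[of _ "transpose i j"])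
      show "misses F f' u k" if "k \<in> M' u" for k
        using that Mv[OF u] sw(2)[of u k] by (auto simp: M'_def split: if_splits)
    qed
    \<comment> \<open>A vertex of \<open>X M i\<close> on the chain misses \<open>i\<close>, so it
      is an end of the chain. The switch thus moves one or two vertices from the class of
      \<open>i\<close> to the empty class of \<open>j\<close>.\<close>
    have "X M i \<inter> S \<subseteq> {w, z}"
    proof
      fix u assume u: "u \<in> X M i \<inter> S"
      then have "misses F f u i" using Mv by (auto simp: X_def)
      then have "mate F f i u = u" by (simp add: mate_def)
      then show "u \<in> {w, z}" using Sz u by auto
    qed
    then have "card (X M i \<inter> S) \<le> card {w, z}" by (intro card_mono) auto
    also have "\<dots> \<le> 2" by (simp add: card_insert_if)
    finally have c2: "card (X M i \<inter> S) \<le> 2" .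
    have c1: "card (X M i \<inter> S) \<ge> 1" using w S fX[of M i] by (auto simp: Suc_le_eq card_gt_0_iff)
    have X'i: "X M' i = X M i - S" and X'j: "X M' j = X M i \<inter> S"
      using Xj ij by (auto simp: X_def M'_def transpose_def split: if_splits)
    have X'k: "X M' k = X M k" if "k \<noteq> i" "k \<noteq> j" for k
      using that by (auto simp: X_def M'_def transpose_def image_iff split: if_splits) 
    define p q where "p = card (X M i)" and "q = card (X M i \<inter> S)"
    have pq: "card (X M i - S) = p - q" "q \<le> p" unfolding p_def q_def
      using fX[of M i] by (auto simp: card_Diff_subset_Int card_mono)
    have split: "\<Phi> M = (card (X M i))\<^sup>2 + (card (X M j))\<^sup>2 + (\<Sum>k\<in>C - {i, j}. (card (X M k))\<^sup>2)" for M
    proof -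
      have "\<Phi> M = (\<Sum>k\<in>{i, j}. (card (X M k))\<^sup>2) + (\<Sum>k\<in>C - {i, j}. (card (X M k))\<^sup>2)"
        unfolding \<Phi>_def using i j Suc.prems(2) by (subst sum.subset_diff[of "{i, j}"]) auto
      then show ?thesis using ij by simp
    qed
    have "(\<Sum>k\<in>C - {i, j}. (card (X M' k))\<^sup>2) = (\<Sum>k\<in>C - {i, j}. (card (X M k))\<^sup>2)"
      by (rule sum.cong) (auto simp: X'k)
    then have "\<Phi> M' + p\<^sup>2 = \<Phi> M + (p - q)\<^sup>2 + q\<^sup>2"
      using split[of M] split[of M'] X'i X'j pq Xj by (simp add: p_def q_def)
    \<comment> \<open>The difference of the two sides is 2q(p - q), which is positive since q is 1
      or 2 and p is at least 3.\<close>
    moreover have "(p - q)\<^sup>2 + q\<^sup>2 < p\<^sup>2"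
    proof -
      obtain r where r: "p = q + r" using pq le_Suc_ex by blast
      then have "r \<ge> 1" "q \<ge> 1" using i3 c1 c2 by (auto simp: p_def q_def)
      then show ?thesis using r by (auto simp: power2_eq_square algebra_simps)
    qed
    ultimately have "\<Phi> M' < \<Phi> M" by linarith
    then show False using min[OF \<open>valid f' M'\<close>] by simp
  qed
  then obtain k u where k: "k \<in> C" "X M k = {u}" by (auto simp: card_1_singleton_iff)
  then have u: "u \<in> N" "k \<in> M u" and uk: "\<And>u'. u' \<in> N \<Longrightarrow> u' \<noteq> u \<Longrightarrow> k \<notin> M u'"
    by (auto simp: X_def set_eq_iff)
  \<comment> \<open>No other set \<open>M u'\<close> contains \<open>k\<close>, so the hypotheses
    survive when \<open>u\<close>, the colour \<open>k\<close> and its colour class are removed,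
    with \<open>x\<close> again as the exceptional vertex.\<close>
  define F1 where "F1 = {e \<in> F. f e \<noteq> k}"
  have "\<exists>f' g. proper_colouring F1 (C - {k}) f' \<and> inj_on g (N - {u}) \<and> g ` (N - {u}) \<subseteq> C - {k} \<and>
          (\<forall>u'\<in>N - {u}. misses F1 f' u' (g u'))"
  proof (rule Suc.hyps(1)[of "N - {u}" "C - {k}" F1 f M x])
    show "n = card (N - {u})" using Suc.hyps(2) u by simp
    show "finite (N - {u})" "finite (C - {k})" using Suc.prems by auto
    show "finite_simple_graph F1" using fs by (auto simp: F1_def finite_simple_graph_def)
    show "proper_colouring F1 (C - {k}) f" using pf by (auto simp: F1_def proper_colouring_def)
    show "card (N - {u}) \<le> card (C - {k})" using Suc.prems(1,2,5) u k by simp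
    fix u' assume u': "u' \<in> N - {u}"
    show "finite (M u') \<and> M u' \<subseteq> C - {k} \<and> (\<forall>k\<in>M u'. misses F1 f u' k)"
      using Mv[of u'] uk[of u'] u' Suc.prems(2) finite_subset by (auto simp: F1_def misses_def)
    show "1 \<le> card (M u')" using Mv[of u'] u' by (auto simp: size'_def)
    show "2 \<le> card (M u')" if "u' \<noteq> x" using Mv[of u'] u' that by (auto simp: size'_def)
  qed
  then obtain f1 g where f1: "proper_colouring F1 (C - {k}) f1" and g: "inj_on g (N - {u})"
    "g ` (N - {u}) \<subseteq> C - {k}" "\<And>u'. u' \<in> N - {u} \<Longrightarrow> misses F1 f1 u' (g u')" by blast
  define f2 where "f2 e = (if f e = k then k else f1 e)" for e
  have uF: "misses F f u k" using Mv[OF u(1)] u(2) by auto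
  have f1k: "f1 e \<in> C" "f1 e \<noteq> k" if "e \<in> F" "f e \<noteq> k" for e
    using f1 that by (auto simp: proper_colouring_def F1_def)
  show ?case
  proof (intro exI conjI ballI)
    show "proper_colouring F C f2"
      using f1 pf k(1) f1k
      unfolding proper_colouring_def f2_def F1_def
      by (smt (verit, ccfv_threshold) image_subset_iff mem_Collect_eq)
    show "inj_on (g(u := k)) N" using g(1,2) by (auto simp: inj_on_def image_subset_iff)
    show "(g(u := k)) ` N \<subseteq> C" using g(2) k by auto
    fix u' assume u': "u' \<in> N"
    show "misses F f2 u' ((g(u := k)) u')"
    proof (cases "u' = u")
      case True
      then show ?thesis using uF f1k by (auto simp: misses_def f2_def)
    next
      case False
      then show ?thesis using g(2) g(3)[of u'] u' by (auto simp: misses_def f2_def F1_def)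
    qed
  qed
qed

section \<open>Degrees and edge colourings\<close>

definition nb :: "'v graph \<Rightarrow> 'v \<Rightarrow> 'v set" where
  "nb F v = {u. {v, u} \<in> F}"

definition del :: "'v graph \<Rightarrow> 'v set \<Rightarrow> 'v graph" where
  "del F X = {e \<in> F. e \<inter> X = {}}"

lemma in_nb: "u \<in> nb F v \<longleftrightarrow> {v, u} \<in> F"
  by (simp add: nb_def)

lemma nb_commute: "u \<in> nb F v \<longleftrightarrow> v \<in> nb F u"
  by (simp add: nb_def insert_commute)

lemma nb_not_self: "finite_simple_graph F \<Longrightarrow> u \<in> nb F v \<Longrightarrow> u \<noteq> v"
  by (auto simp: nb_def finite_simple_graph_def)

lemma nb_subset_vertices: "nb F v \<subseteq> \<Union>F"
  by (auto simp: nb_def)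

lemma nb_mono: "F' \<subseteq> F \<Longrightarrow> nb F' v \<subseteq> nb F v"
  by (auto simp: nb_def)

lemma nb_del: "nb (del F {x}) u = (if u = x then {} else nb F u - {x})"
  by (auto simp: nb_def del_def)

lemma finite_simple_graph_subset:
  "finite_simple_graph F \<Longrightarrow> F' \<subseteq> F \<Longrightarrow> finite_simple_graph F'"
  by (auto simp: finite_simple_graph_def intro: finite_subset)

lemma finite_vertices:
  assumes "finite_simple_graph F" shows "finite (\<Union>F)"
proof -
  have "finite e" if "e \<in> F" for e
    using assms that by (intro card_ge_0_finite) (auto simp: finite_simple_graph_def)
  then show ?thesis using assms by (auto simp: finite_simple_graph_def)
qed

lemma finite_nb: "finite_simple_graph F \<Longrightarrow> finite (nb F v)"
  using finite_vertices nb_subset_vertices finite_subset by metis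

lemma del_subset: "del F X \<subseteq> F"
  by (auto simp: del_def)

lemma finite_simple_graph_del: "finite_simple_graph F \<Longrightarrow> finite_simple_graph (del F X)"
  using finite_simple_graph_subset del_subset by metis

lemma incident_eq_image:
  assumes "finite_simple_graph F" shows "{e \<in> F. v \<in> e} = (\<lambda>u. {v, u}) ` nb F v"
proof -
  have "\<exists>u. {v, u} \<in> F \<and> e = {v, u}" if "e \<in> F" "v \<in> e" for e
    using simple_edgeE[OF assms that] that by metis
  then show ?thesis by (auto simp: nb_def image_iff)
qed

lemma card_incident:
  assumes "finite_simple_graph F" shows "card {e \<in> F. v \<in> e} = card (nb F v)"
  unfolding incident_eq_image[OF assms]
  by (rule card_image) (auto simp: inj_on_def doubleton_eq_iff)

lemma vertex_iff_nb:
  assumes "finite_simple_graph F" shows "v \<in> \<Union>F \<longleftrightarrow> nb F v \<noteq> {}"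
  using incident_eq_image[OF assms, of v] by blast

lemma card_del:
  assumes "finite_simple_graph F" shows "card F = card (nb F v) + card (del F {v})"
proof -
  have "finite F" using assms by (simp add: finite_simple_graph_def)
  then have "card ({e \<in> F. v \<in> e} \<union> del F {v}) = card {e \<in> F. v \<in> e} + card (del F {v})"
    by (intro card_Un_disjoint) (auto simp: del_def)
  moreover have "{e \<in> F. v \<in> e} \<union> del F {v} = F" by (auto simp: del_def)
  ultimately show ?thesis using card_incident[OF assms] by simp
qed

lemma handshake:
  assumes "finite_simple_graph F" shows "(\<Sum>v\<in>\<Union>F. card (nb F v)) = 2 * card F"
proof -
  have "finite F" using assms by (simp add: finite_simple_graph_def)
  have "(\<Sum>v\<in>\<Union>F. card {e \<in> F. v \<in> e}) = 2 * card F"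
  proof (rule sum_multicount)
    show "\<forall>e\<in>F. card {v \<in> \<Union>F. v \<in> e} = 2"
    proof
      fix e assume "e \<in> F"
      then have "{v \<in> \<Union>F. v \<in> e} = e" by auto
      then show "card {v \<in> \<Union>F. v \<in> e} = 2" using \<open>e \<in> F\<close> assms by (simp add: finite_simple_graph_def)
    qed
  qed (use finite_vertices[OF assms] \<open>finite F\<close> in auto)
  then show ?thesis using card_incident[OF assms] by simp
qed

section \<open>Extending a proper edge colouring by one vertex\<close>

definition colourable :: "'v graph \<Rightarrow> nat \<Rightarrow> bool" where
  "colourable F k \<longleftrightarrow> (\<exists>f. proper_colouring F {..<k} f)"

text \<open>Without \<open>v\<close>, a neighbour \<open>u\<close> meets one edge fewer, so it
  misses at least two colours, or at least one if its degree is \<open>k\<close>. After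
  \<open>fan_recolouring\<close> the edges at \<open>v\<close> can receive distinct colours, each
  missing at the other end.\<close>

lemma colourable_extend_vertex:
  assumes fs: "finite_simple_graph F" and col: "colourable (del F {v}) k"
    and dv: "card (nb F v) \<le> k" and du: "\<And>u. u \<in> nb F v \<Longrightarrow> card (nb F u) \<le> k"
    and one: "card {u \<in> nb F v. card (nb F u) = k} \<le> 1"
  shows "colourable F k"
proof -
  define F' where "F' = del F {v}"
  have fs': "finite_simple_graph F'" using fs finite_simple_graph_del unfolding F'_def by metis
  obtain f where f: "proper_colouring F' {..<k} f" using col by (auto simp: colourable_def F'_def)
  define M where "M u = {c \<in> {..<k}. misses F' f u c}" for u
  have Mc: "k + 1 \<le> card (M u) + card (nb F u)" if u: "u \<in> nb F v" for u
  proof -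
    have "u \<noteq> v" using nb_not_self[OF fs u] .
    then have "nb F' u = nb F u - {v}" by (simp add: F'_def nb_del)
    moreover have "v \<in> nb F u" using u nb_commute by metis
    ultimately have n: "card (nb F u) = card (nb F' u) + 1"
      using finite_nb[OF fs, of u] by (metis Suc_eq_plus1 card_Suc_Diff1)
    have "{..<k} = M u \<union> f ` {e \<in> F'. u \<in> e}"
      using f by (auto simp: M_def misses_def proper_colouring_def)
    then have "k = card (M u \<union> f ` {e \<in> F'. u \<in> e})" by (metis card_lessThan)
    also have "\<dots> \<le> card (M u) + card (f ` {e \<in> F'. u \<in> e})" by (rule card_Un_le)
    also have "card (f ` {e \<in> F'. u \<in> e}) \<le> card {e \<in> F'. u \<in> e}"
      using fs' by (intro card_image_le) (auto simp: finite_simple_graph_def)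
    also have "\<dots> = card (nb F' u)" using card_incident[OF fs'] .
    finally show ?thesis using n by simp
  qed
  \<comment> \<open>This picks the only neighbour of degree \<open>k\<close> if there is one.
    Otherwise its value does not matter, because every neighbour misses two colours.\<close>
  define u0 where "u0 = (SOME u. u \<in> nb F v \<and> card (nb F u) = k)"
  have u0: "u = u0" if u: "u \<in> nb F v" "card (nb F u) = k" for u
  proof -
    have "u0 \<in> {u \<in> nb F v. card (nb F u) = k}" unfolding u0_def using someI_ex[of "\<lambda>u. u \<in> nb F v \<and> card (nb F u) = k"] u by auto
    moreover have "finite {u \<in> nb F v. card (nb F u) = k}" using finite_nb[OF fs] by simp
    ultimately show ?thesis using one u card_le_Suc0_iff_eq[of "{u \<in> nb F v. card (nb F u) = k}"] by auto
  qed
  have "\<exists>f' g. proper_colouring F' {..<k} f' \<and> inj_on g (nb F v) \<and> g ` nb F v \<subseteq> {..<k} \<and>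
      (\<forall>u\<in>nb F v. misses F' f' u (g u))"
  proof (rule fan_recolouring[OF finite_nb[OF fs] _ fs' f, of v M u0])
    show "card (nb F v) \<le> card {..<k}" using dv by simp
    fix u assume u: "u \<in> nb F v"
    show "finite (M u) \<and> M u \<subseteq> {..<k} \<and> (\<forall>c\<in>M u. misses F' f u c)" by (auto simp: M_def)
    show "1 \<le> card (M u)" using Mc[OF u] du[OF u] by simp
    show "2 \<le> card (M u)" if "u \<noteq> u0" using Mc[OF u] du[OF u] u0[OF u] that by fastforce
  qed simp
  then obtain f' g where f': "proper_colouring F' {..<k} f'" and g: "inj_on g (nb F v)"
    "g ` nb F v \<subseteq> {..<k}" "\<And>u. u \<in> nb F v \<Longrightarrow> misses F' f' u (g u)" by blast
  \<comment> \<open>The edge from \<open>v\<close> to \<open>u\<close> gets \<open>g u\<close>.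
    Injectivity of \<open>g\<close> prevents conflicts at \<open>v\<close>, and the fact that
    \<open>g u\<close> is missing at \<open>u\<close> prevents them at the other end.\<close>
  define h where "h e = (if v \<in> e then g (SOME u. e = {v, u}) else f' e)" for e
  have hv: "h {v, u} = g u" if "u \<in> nb F v" for u
  proof -
    have "(SOME u'. {v, u} = {v, u'}) = u"
      using nb_not_self[OF fs that] by (intro some_equality) (auto simp: doubleton_eq_iff)
    then show ?thesis by (simp add: h_def)
  qed
  have ev: "\<exists>u\<in>nb F v. e = {v, u}" if "e \<in> F" "v \<in> e" for e
    using incident_eq_image[OF fs, of v] that by auto
  have nv: "h e = f' e" "e \<in> F'" if "e \<in> F" "v \<notin> e" for e
    using that by (auto simp: h_def F'_def del_def)
  have mixed: "h e \<noteq> h e'" if m: "e \<in> F" "e' \<in> F" "v \<in> e" "v \<notin> e'" "e \<inter> e' \<noteq> {}" for e e'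
  proof -
    obtain u where u: "u \<in> nb F v" "e = {v, u}" using ev[of e] m by blast
    then have "u \<in> e'" using m by auto
    then show ?thesis using g(3)[OF u(1)] u hv nv[of e'] m by (auto simp: misses_def)
  qed
  have "proper_colouring F {..<k} h"
    unfolding proper_colouring_def
  proof (intro conjI ballI impI)
    have "h e \<in> {..<k}" if "e \<in> F" for e
    proof (cases "v \<in> e")
      case True
      then show ?thesis using ev[OF that] hv g(2) by auto
    next
      case False
      then show ?thesis using nv[OF that] f' by (auto simp: proper_colouring_def)
    qed
    then show "h ` F \<subseteq> {..<k}" by blast
    fix e e' assume e: "e \<in> F" "e' \<in> F" "e \<noteq> e'" "e \<inter> e' \<noteq> {}"
    show "h e \<noteq> h e'"
    proof (cases "v \<in> e"; cases "v \<in> e'")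
      assume "v \<in> e" "v \<in> e'"
      then obtain u u' where "u \<in> nb F v" "u' \<in> nb F v" "e = {v, u}" "e' = {v, u'}" using ev[of e] ev[of e'] e by metis
      then show ?thesis using hv g(1) e by (auto simp: inj_on_def)
    next
      assume "v \<notin> e" "v \<notin> e'"
      then show ?thesis using nv f' e by (auto simp: proper_colouring_def)
    next
      assume "v \<in> e" "v \<notin> e'"
      then show ?thesis using mixed e by blast
    next
      assume "v \<notin> e" "v \<in> e'"
      then show ?thesis using mixed[of e' e] e by (metis Int_commute)
    qed
  qed
  then show ?thesis by (auto simp: colourable_def)
qed

text \<open>Vertices with at most one neighbour of degree \<open>k\<close> are stripped off
  repeatedly. By the extension lemma no removal makes the graph colourable, so stripping stops
  before the graph is empty.\<close>

lemma not_colourable_critical: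
  assumes "finite_simple_graph F" "\<And>v. card (nb F v) \<le> k" "\<not> colourable F k"
  shows "\<exists>F'\<subseteq>F. F' \<noteq> {} \<and> (\<forall>v\<in>\<Union>F'. card {u \<in> nb F' v. card (nb F' u) = k} \<ge> 2)"
  using assms
proof (induction "card F" arbitrary: F rule: less_induct)
  case less
  note fs = less.prems(1)
  have ne: "F \<noteq> {}" using less.prems(3) by (auto simp: colourable_def proper_colouring_def)
  show ?case
  proof (cases "\<exists>v\<in>\<Union>F. card {u \<in> nb F v. card (nb F u) = k} \<le> 1")
    case True
    then obtain v where v: "v \<in> \<Union>F" "card {u \<in> nb F v. card (nb F u) = k} \<le> 1" by auto
    have nc: "\<not> colourable (del F {v}) k"
      using colourable_extend_vertex[OF fs _ less.prems(2) less.prems(2) v(2)] less.prems(3) by blast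
    have lt: "card (del F {v}) < card F"
      using card_del[OF fs, of v] vertex_iff_nb[OF fs, of v] v(1) finite_nb[OF fs, of v] card_gt_0_iff[of "nb F v"] by linarith
    have dg: "card (nb (del F {v}) u) \<le> k" for u
      using less.prems(2)[of u] card_mono[OF finite_nb[OF fs] nb_mono[OF del_subset[of F "{v}"]], of u] by linarith
    show ?thesis
      using less.hyps[OF lt finite_simple_graph_del[OF fs] dg nc] del_subset[of F "{v}"]
      by (meson subset_trans)
  next
    case False
    then show ?thesis using ne by (intro exI[of _ F]) (simp add: not_le numeral_2_eq_2 Suc_le_eq)
  qed
qed

section \<open>Deleting vertices\<close>

text \<open>Greedy filling, one capacity after another. It is applied twice: to share
  \<open>D\<close> proper colours among the \<open>t\<close> colours, and to share deleted vertices
  among them.\<close>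

lemma distribute_with_capacities:
  assumes "finite S" "finite X" "card X \<le> (\<Sum>s\<in>S. c s)"
  shows "\<exists>g. g ` X \<subseteq> S \<and> (\<forall>s\<in>S. card {x \<in> X. g x = s} \<le> c s)"
  using assms
proof (induction S arbitrary: X rule: finite_induct)
  case empty
  then show ?case by auto
next
  case (insert s S)
  obtain Y where Y: "Y \<subseteq> X" "card Y = min (c s) (card X)"
    by (metis min.cobounded2 obtain_subset_with_card_n)
  have "card (X - Y) \<le> (\<Sum>s\<in>S. c s)"
    using insert.prems insert.hyps Y by (simp add: card_Diff_subset finite_subset)
  then obtain g where g: "g ` (X - Y) \<subseteq> S" "\<forall>r\<in>S. card {x \<in> X - Y. g x = r} \<le> c r"
    using insert.IH[of "X - Y"] insert.prems by auto
  define h where "h x = (if x \<in> Y then s else g x)" for x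
  have "{x \<in> X. h x = s} = Y" using Y g insert.hyps by (auto simp: h_def split: if_splits)
  moreover have "{x \<in> X. h x = r} = {x \<in> X - Y. g x = r}" if "r \<in> S" for r
    using that insert.hyps by (auto simp: h_def)
  moreover have "h ` X \<subseteq> insert s S" using g by (auto simp: h_def)
  ultimately show ?case using g(2) Y(2) by (intro exI[of _ h]) auto
qed

definition star_on :: "'v \<Rightarrow> 'v set \<Rightarrow> 'v graph" where
  "star_on v L = (\<lambda>u. {v, u}) ` L"

text \<open>A conflict between the two stars can only occur at a common leaf. This settles the
  situation where two stars share leaves and one common leaf has been deleted.\<close>

lemma two_stars_colourable:
  assumes "v \<noteq> c" "v \<notin> P" "v \<notin> R" "c \<notin> P" "c \<notin> R" and fin: "finite P" "finite R"
    and k: "card P \<le> k" "card R \<le> k" "k \<ge> 2 \<or> P \<inter> R = {}"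
  shows "colourable (star_on v P \<union> star_on c R) k"
proof -
  obtain h where h: "inj_on h R" "h ` R \<subseteq> {..<k}"
    using card_le_inj[OF fin(2), of "{..<k}"] k by auto
  \<comment> \<open>The edge from \<open>c\<close> to \<open>u\<close> has colour
    \<open>h u\<close>; at a common leaf the edge from \<open>v\<close> takes the cyclically next
    colour, a different one since \<open>k\<close> is at least 2 when common leaves exist. The other
    leaves of \<open>v\<close> use colours outside the range of \<open>g0\<close>.\<close>
  define g0 where "g0 u = Suc (h u) mod k" for u
  have g0: "inj_on g0 (P \<inter> R)" "g0 ` (P \<inter> R) \<subseteq> {..<k}" "\<And>u. u \<in> P \<inter> R \<Longrightarrow> g0 u \<noteq> h u"
  proof -
    have hk: "h u < k" if "u \<in> R" for u using h that by auto
    show "inj_on g0 (P \<inter> R)"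
    proof (rule inj_onI)
      fix x y assume xy: "x \<in> P \<inter> R" "y \<in> P \<inter> R" "g0 x = g0 y"
      then have "h x = h y" using hk[of x] hk[of y]
        by (auto simp: g0_def mod_Suc split: if_splits)
      then show "x = y" using h(1) xy by (auto simp: inj_on_def)
    qed
    show "g0 ` (P \<inter> R) \<subseteq> {..<k}" using hk by (auto simp: g0_def intro!: mod_less_divisor intro: gr_zeroI dest: hk)
    show "g0 u \<noteq> h u" if "u \<in> P \<inter> R" for u
      using hk[of u] k(3) that by (auto simp: g0_def mod_Suc split: if_splits)
  qed
  have "card (P - R) \<le> card ({..<k} - g0 ` (P \<inter> R))"
    using g0(1,2) fin k by (simp add: card_Diff_subset card_image card_Diff_subset_Int)
  then obtain g1 where g1: "inj_on g1 (P - R)" "g1 ` (P - R) \<subseteq> {..<k} - g0 ` (P \<inter> R)"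
    using card_le_inj[of "P - R" "{..<k} - g0 ` (P \<inter> R)"] fin by auto
  define g where "g u = (if u \<in> R then g0 u else g1 u)" for u
  have g: "inj_on g P" "g ` P \<subseteq> {..<k}" "\<And>u. u \<in> P \<inter> R \<Longrightarrow> g u \<noteq> h u"
    using g0 g1 by (auto simp: g_def inj_on_def)
  define f where "f e = (if v \<in> e then g (the_elem (e - {v})) else h (the_elem (e - {c})))" for e
  have fv: "f {v, u} = g u" if "u \<in> P" for u
  proof -
    have "{v, u} - {v} = {u}" using that assms by auto
    then show ?thesis by (simp add: f_def)
  qed
  have fc: "f {c, u} = h u" if "u \<in> R" for u
  proof -
    have "{c, u} - {c} = {u}" "v \<notin> {c, u}" using that assms by auto
    then show ?thesis by (simp add: f_def)
  qed
  have "proper_colouring (star_on v P \<union> star_on c R) {..<k} f"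
    unfolding proper_colouring_def
  proof (intro conjI ballI impI)
    show "f ` (star_on v P \<union> star_on c R) \<subseteq> {..<k}"
      using fv fc g h by (auto simp: star_on_def)
    fix e e' assume e: "e \<in> star_on v P \<union> star_on c R" "e' \<in> star_on v P \<union> star_on c R"
      and ne: "e \<noteq> e'" "e \<inter> e' \<noteq> {}"
    have mixed: "f e \<noteq> f e'" if m: "e \<in> star_on v P" "e' \<in> star_on c R" "e \<inter> e' \<noteq> {}" for e e'
    proof -
      obtain u u' where u: "u \<in> P" "e = {v, u}" "u' \<in> R" "e' = {c, u'}"
        using m by (auto simp: star_on_def)
      then have "u' = u" using m(3) assms(1-5) by auto
      then show ?thesis using u g(3)[of u] fv[of u] fc[of u] by auto
    qed
    consider "e \<in> star_on v P" "e' \<in> star_on v P" | "e \<in> star_on c R" "e' \<in> star_on c R"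
      | "e \<in> star_on v P" "e' \<in> star_on c R" | "e' \<in> star_on v P" "e \<in> star_on c R"
      using e by blast
    then show "f e \<noteq> f e'"
    proof cases
      case 1
      then obtain u u' where "u \<in> P" "e = {v, u}" "u' \<in> P" "e' = {v, u'}" unfolding star_on_def by blast
      then show ?thesis using ne(1) fv[of u] fv[of u'] inj_onD[OF g(1), of u u'] by auto
    next
      case 2
      then obtain u u' where "u \<in> R" "e = {c, u}" "u' \<in> R" "e' = {c, u'}" unfolding star_on_def by blast
      then show ?thesis using ne(1) fc[of u] fc[of u'] inj_onD[OF h(1), of u u'] by auto
    next
      case 3
      then show ?thesis using mixed ne by blast
    next
      case 4
      then show ?thesis using mixed[of e' e] ne by (metis Int_commute)
    qed
  qed
  then show ?thesis by (auto simp: colourable_def)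
qed

text \<open>If \<open>k\<close> is the maximum degree, this is the vertex set of the core in the
  sense of edge colouring theory, the part of the graph on which the extension lemma can
  fail.\<close>

definition core :: "'v graph \<Rightarrow> nat \<Rightarrow> 'v set" where
  "core F k = {v \<in> \<Union>F. card (nb F v) = k}"

lemma finite_core: "finite_simple_graph F \<Longrightarrow> finite (core F k)"
  by (rule finite_subset[OF _ finite_vertices[of F]]) (auto simp: core_def)

section \<open>Good graphs, vertex deletion and the lower bound on the number of edges\<close>

locale star_ramsey =
  fixes t :: nat and b :: "nat \<Rightarrow> nat"
  assumes b_pos: "s \<in> {1..t} \<Longrightarrow> b s \<ge> 1"
begin

definition D :: nat where "D = (\<Sum>s=1..t. b s - 1)"

text \<open>As \<open>D\<close> sums the excesses \<open>b s - 1\<close>, this means that two of the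
  \<open>b s\<close> equal 2 and all others equal 1: the condition on \<open>b\<close> in
  alternative (2), before ordering.\<close>

definition exc :: bool where
  "exc \<longleftrightarrow> D = 2 \<and> (\<exists>r\<in>{1..t}. \<exists>s\<in>{1..t}. r \<noteq> s \<and> b r = 2 \<and> b s = 2)"

definition good :: "'v graph \<Rightarrow> bool" where
  "good F \<longleftrightarrow> (\<exists>f. f ` F \<subseteq> {1..t} \<and> (\<forall>v. \<forall>s\<in>{1..t}. card {e \<in> F. v \<in> e \<and> f e = s} < b s))"

definition kill :: "'v graph \<Rightarrow> nat \<Rightarrow> bool" where
  "kill F k \<longleftrightarrow> (\<exists>X. finite X \<and> card X \<le> k \<and> good (del F X))"

text \<open>The \<open>D\<close> matchings are merged into \<open>t\<close> classes, at most
  \<open>b s - 1\<close> of them into class \<open>s\<close>. Each matching contributes at most one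
  edge at a vertex.\<close>

lemma colourable_imp_good:
  assumes fs: "finite_simple_graph F" and col: "colourable F D"
  shows "good F"
proof -
  obtain f where f: "proper_colouring F {..<D} f" using col by (auto simp: colourable_def)
  obtain g where g: "g ` {..<D} \<subseteq> {1..t}" "\<forall>s\<in>{1..t}. card {x \<in> {..<D}. g x = s} \<le> b s - 1"
    using distribute_with_capacities[of "{1..t}" "{..<D}" "\<lambda>s. b s - 1"] by (auto simp: D_def)
  have "card {e \<in> F. v \<in> e \<and> g (f e) = s} < b s" if s: "s \<in> {1..t}" for v s
  proof -
    have "card {e \<in> F. v \<in> e \<and> g (f e) = s} = card (f ` {e \<in> F. v \<in> e \<and> g (f e) = s})"
      by (rule card_image[symmetric], rule inj_onI) (use f in \<open>auto simp: proper_colouring_def\<close>)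
    also have "\<dots> \<le> card {x \<in> {..<D}. g x = s}"
      using f by (intro card_mono) (auto simp: proper_colouring_def)
    also have "\<dots> \<le> b s - 1" using g s by auto
    also have "\<dots> < b s" using b_pos[OF s] by simp
    finally show ?thesis .
  qed
  moreover have "(\<lambda>e. g (f e)) ` F \<subseteq> {1..t}"
    using g(1) f unfolding proper_colouring_def by blast
  ultimately show ?thesis unfolding good_def by (intro exI[of _ "\<lambda>e. g (f e)"]) simp
qed

lemma good_empty: "good {}"
  using b_pos by (auto simp: good_def Suc_le_eq)

lemma good_Un:
  assumes "good F" "good F'" "\<Union>F \<inter> \<Union>F' = {}"
  shows "good (F \<union> F')"
proof -
  obtain f where f: "f ` F \<subseteq> {1..t}" "\<And>v s. s \<in> {1..t} \<Longrightarrow> card {e \<in> F. v \<in> e \<and> f e = s} < b s"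
    using assms(1) by (auto simp: good_def)
  obtain f' where f': "f' ` F' \<subseteq> {1..t}" "\<And>v s. s \<in> {1..t} \<Longrightarrow> card {e \<in> F'. v \<in> e \<and> f' e = s} < b s"
    using assms(2) by (auto simp: good_def)
  define h where "h e = (if e \<in> F then f e else f' e)" for e
  have "card {e \<in> F \<union> F'. v \<in> e \<and> h e = s} < b s" if s: "s \<in> {1..t}" for v s
  proof (cases "v \<in> \<Union>F")
    case True
    then have "{e \<in> F \<union> F'. v \<in> e \<and> h e = s} = {e \<in> F. v \<in> e \<and> f e = s}"
      using assms(3) by (auto simp: h_def)
    then show ?thesis using f(2)[OF s] by simp
  next
    case False
    then have "{e \<in> F \<union> F'. v \<in> e \<and> h e = s} = {e \<in> F'. v \<in> e \<and> f' e = s}"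
      by (auto simp: h_def)
    then show ?thesis using f'(2)[OF s] by simp
  qed
  moreover have "h ` (F \<union> F') \<subseteq> {1..t}" using f(1) f'(1) by (auto simp: h_def)
  ultimately show ?thesis unfolding good_def by (intro exI[of _ h]) simp
qed

lemma good_subset:
  assumes "good F" "F' \<subseteq> F" "finite F" shows "good F'"
proof -
  obtain f where f: "f ` F \<subseteq> {1..t}" "\<And>v s. s \<in> {1..t} \<Longrightarrow> card {e \<in> F. v \<in> e \<and> f e = s} < b s"
    using assms(1) by (auto simp: good_def)
  have "card {e \<in> F'. v \<in> e \<and> f e = s} < b s" if "s \<in> {1..t}" for v s
    using f(2)[OF that, of v] card_mono[of "{e \<in> F. v \<in> e \<and> f e = s}" "{e \<in> F'. v \<in> e \<and> f e = s}"] assms(2,3)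
    by fastforce
  moreover have "f ` F' \<subseteq> {1..t}" using f(1) assms(2) by blast
  ultimately show ?thesis unfolding good_def by (intro exI[of _ f]) simp
qed

lemma good_imp_kill: "good F \<Longrightarrow> kill F k"
  unfolding kill_def by (intro exI[of _ "{}"]) (simp add: del_def)

lemma kill_del:
  assumes "kill (del F {v}) k" shows "kill F (Suc k)"
proof -
  obtain X where X: "finite X" "card X \<le> k" "good (del (del F {v}) X)" using assms by (auto simp: kill_def)
  moreover have "del (del F {v}) X = del F (insert v X)" by (auto simp: del_def)
  ultimately show ?thesis unfolding kill_def
    by (intro exI[of _ "insert v X"]) (simp add: card_insert_if)
qed

lemma kill_Un:
  assumes "kill F k" "kill F' k'" "\<Union>F \<inter> \<Union>F' = {}" "finite F" "finite F'"
  shows "kill (F \<union> F') (k + k')"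
proof -
  obtain X X' where X: "finite X" "card X \<le> k" "good (del F X)" and X': "finite X'" "card X' \<le> k'" "good (del F' X')"
    using assms by (auto simp: kill_def)
  have "good (del F X \<union> del F' X')"
    using X X' assms(3) by (intro good_Un) (auto simp: del_def)
  then have "good (del (F \<union> F') (X \<union> X'))"
    using assms(4,5) by (elim good_subset) (auto simp: del_def)
  moreover have "card (X \<union> X') \<le> k + k'" using card_Un_le[of X X'] X X' by linarith
  ultimately show ?thesis unfolding kill_def using X X' by blast
qed

text \<open>A bad graph is not \<open>D\<close>-colourable, so it has a critical subgraph. A vertex
  of degree \<open>D\<close> in that subgraph has degree \<open>D\<close> in \<open>F\<close> too,
  as no degree exceeds \<open>D\<close>.\<close>

lemma not_good_core:
  assumes fs: "finite_simple_graph F" and dg: "\<And>v. card (nb F v) \<le> D" and ng: "\<not> good F"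
  shows "\<exists>v\<in>core F D. card (nb F v \<inter> core F D) \<ge> 2"
proof -
  have "\<not> colourable F D" using colourable_imp_good[OF fs] ng by blast
  then obtain F' where F': "F' \<subseteq> F" "F' \<noteq> {}"
    and F'v: "\<And>v. v \<in> \<Union>F' \<Longrightarrow> card {u \<in> nb F' v. card (nb F' u) = D} \<ge> 2"
    using not_colourable_critical[OF fs dg] by metis
  have fs': "finite_simple_graph F'" using finite_simple_graph_subset[OF fs F'(1)] .
  have up: "u \<in> core F D" if "card (nb F' u) = D" "u \<in> \<Union>F'" for u
  proof -
    have "card (nb F' u) \<le> card (nb F u)" by (rule card_mono[OF finite_nb[OF fs] nb_mono[OF F'(1)]])
    then have "card (nb F u) = D" using dg[of u] that by simp
    then show ?thesis using that F'(1) by (auto simp: core_def)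
  qed
  obtain e where "e \<in> F'" using F'(2) by blast
  moreover from this have "e \<noteq> {}" using fs' by (auto simp: finite_simple_graph_def)
  ultimately obtain v0 where "v0 \<in> \<Union>F'" by blast
  \<comment> \<open>Moving from \<open>v0\<close> to such a neighbour gives a vertex
    \<open>v\<close> that is itself in the core; criticality at \<open>v\<close> then provides its
    two core neighbours.\<close>
  then have "{u \<in> nb F' v0. card (nb F' u) = D} \<noteq> {}" using F'v[of v0] by (metis card.empty not_numeral_le_zero)
  then obtain v where v: "card (nb F' v) = D" "v \<in> \<Union>F'" using nb_subset_vertices[of F' v0] by blast
  have "{u \<in> nb F' v. card (nb F' u) = D} \<subseteq> nb F v \<inter> core F D"
    using nb_mono[OF F'(1), of v] nb_subset_vertices[of F' v] up by auto
  then have "card {u \<in> nb F' v. card (nb F' u) = D} \<le> card (nb F v \<inter> core F D)"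
    using finite_nb[OF fs] by (intro card_mono) auto
  then show ?thesis using F'v[OF v(2)] up[OF v] by (intro bexI[of _ v]) auto
qed

text \<open>Deleting a core vertex with two core neighbours takes three vertices out of the core.\<close>

lemma core_bound:
  assumes "finite_simple_graph F" "\<And>v. card (nb F v) \<le> D" "\<not> kill F m"
    and "\<And>F'. F' \<subseteq> F \<Longrightarrow> \<not> good F' \<Longrightarrow> card (core F' D) \<ge> c"
  shows "3 * m + c \<le> card (core F D)"
  using assms
proof (induction m arbitrary: F)
  case 0
  then show ?case using good_imp_kill by auto
next
  case (Suc m)
  note fs = Suc.prems(1)
  have fc: "finite (core F D)" using finite_core[OF fs] .
  have ng: "\<not> good F" using good_imp_kill Suc.prems(3) by blast
  obtain v where v: "v \<in> core F D" "card (nb F v \<inter> core F D) \<ge> 2"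
    using not_good_core[OF fs Suc.prems(2) ng] by blast
  have nk: "\<not> kill (del F {v}) m" using kill_del[of F v m] Suc.prems(3) by blast
  have dg: "card (nb (del F {v}) u) \<le> card (nb F u)" for u
    by (rule card_mono[OF finite_nb[OF fs] nb_mono[OF del_subset]])
  have IH: "3 * m + c \<le> card (core (del F {v}) D)"
    using Suc.prems(4) del_subset[of F "{v}"]
    by (intro Suc.IH finite_simple_graph_del[OF fs] nk le_trans[OF dg Suc.prems(2)]) (metis subset_trans)
  \<comment> \<open>Degrees do not grow under deletion, so no vertex enters the core, while the
    neighbours of \<open>v\<close> lose an edge and leave it.\<close>
  have sub: "core (del F {v}) D \<subseteq> core F D - insert v (nb F v \<inter> core F D)"
  proof
    fix u assume u: "u \<in> core (del F {v}) D"
    then have "u \<noteq> v" by (auto simp: core_def del_def)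
    have uF: "u \<in> \<Union>F" "card (nb (del F {v}) u) = D" using u by (auto simp: core_def del_def)
    then have uD: "card (nb F u) = D" using dg[of u] Suc.prems(2)[of u] by simp
    have "u \<notin> nb F v"
    proof
      assume "u \<in> nb F v"
      then have "v \<in> nb F u" using nb_commute by metis
      then have "card (nb F u - {v}) < card (nb F u)" using finite_nb[OF fs] by (intro psubset_card_mono) auto
      then show False using uD uF \<open>u \<noteq> v\<close> by (simp add: nb_del)
    qed
    then show "u \<in> core F D - insert v (nb F v \<inter> core F D)" using \<open>u \<noteq> v\<close> uF uD by (auto simp: core_def)
  qed
  have "v \<notin> nb F v" using nb_not_self[OF fs] by blast
  then have 3: "card (insert v (nb F v \<inter> core F D)) \<ge> 3" using v(2) finite_nb[OF fs, of v] by simp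
  have "insert v (nb F v \<inter> core F D) \<subseteq> core F D" using v(1) by auto
  then have "card (core F D) = card (core F D - insert v (nb F v \<inter> core F D)) + card (insert v (nb F v \<inter> core F D))"
    using fc by (metis card_Diff_subset card_mono finite_subset le_add_diff_inverse2)
  moreover have "card (core (del F {v}) D) \<le> card (core F D - insert v (nb F v \<inter> core F D))"
    using sub fc by (intro card_mono) auto
  ultimately show ?case using IH 3 unfolding mult_Suc_right by linarith
qed

text \<open>The base value 3 comes from a core vertex together with two core neighbours, which every
  bad subgraph has.\<close>

lemma core_bound_3:
  assumes fs: "finite_simple_graph F" and dg: "\<And>v. card (nb F v) \<le> D" and "\<not> kill F m"
  shows "3 * m + 3 \<le> card (core F D)"
proof (rule core_bound[OF assms])
  fix F' assume F': "F' \<subseteq> F" "\<not> good F'"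
  have fs': "finite_simple_graph F'" using finite_simple_graph_subset[OF fs F'(1)] .
  have "card (nb F' v) \<le> D" for v
    using dg[of v] card_mono[OF finite_nb[OF fs] nb_mono[OF F'(1)], of v] by linarith
  then obtain v where v: "v \<in> core F' D" "card (nb F' v \<inter> core F' D) \<ge> 2" using not_good_core[OF fs' _ F'(2)] by metis
  have "v \<notin> nb F' v" using nb_not_self[OF fs'] by blast
  then have "card (insert v (nb F' v \<inter> core F' D)) \<ge> 3" using v(2) finite_nb[OF fs', of v] by simp
  also have "card (insert v (nb F' v \<inter> core F' D)) \<le> card (core F' D)"
    using v(1) finite_core[OF fs'] by (intro card_mono) auto
  finally show "3 \<le> card (core F' D)" .
qed

lemma core_degree_sum:
  assumes fs: "finite_simple_graph F"
  shows "2 * card F = D * card (core F D) + (\<Sum>v\<in>\<Union>F - core F D. card (nb F v))"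
proof -
  have "(\<Sum>v\<in>\<Union>F. card (nb F v)) = (\<Sum>v\<in>\<Union>F - core F D. card (nb F v)) + (\<Sum>v\<in>core F D. card (nb F v))"
    using finite_vertices[OF fs] by (intro sum.subset_diff) (auto simp: core_def)
  moreover have "(\<Sum>v\<in>core F D. card (nb F v)) = (\<Sum>v\<in>core F D. D)" by (rule sum.cong) (auto simp: core_def)
  ultimately show ?thesis using handshake[OF fs] by simp
qed

lemma small_degree_good:
  assumes fs: "finite_simple_graph F" and dg: "\<And>v. card (nb F v) \<le> D" and D: "D \<le> 1"
  shows "good F"
proof (rule ccontr)
  assume "\<not> good F"
  then obtain v where "v \<in> core F D" "card (nb F v \<inter> core F D) \<ge> 2" using not_good_core[OF fs dg] by blast
  moreover have "card (nb F v \<inter> core F D) \<le> card (nb F v)" using finite_nb[OF fs] by (intro card_mono) auto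
  ultimately show False using dg[of v] D by linarith
qed

text \<open>Deleting a vertex of degree at least \<open>D + 1\<close> lowers \<open>m\<close> by one
  and removes enough edges. If there is none, then \<open>D\<close> is at least 2 and the core has
  at least 3(m + 1) vertices, so twice the number of edges is at least 3(m + 1)D, which is at least
  2(m + 1)(D + 1).\<close>

lemma card_lower_bound:
  assumes "finite_simple_graph F" "\<not> kill F m"
  shows "(m + 1) * (D + 1) \<le> card F"
  using assms
proof (induction m arbitrary: F)
  case 0
  show ?case
  proof (cases "\<exists>v. card (nb F v) \<ge> D + 1")
    case True
    then obtain v where "card (nb F v) \<ge> D + 1" ..
    then show ?thesis using card_del[OF 0(1), of v] by simp
  next
    case False
    then have dg: "card (nb F v) \<le> D" for v by (metis Suc_eq_plus1 not_less_eq_eq)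
    then have "D \<ge> 2" using small_degree_good[OF 0(1)] good_imp_kill 0(2) by force
    moreover have "3 \<le> card (core F D)" using core_bound_3[OF 0(1) dg 0(2)] by simp
    then have "D * 3 \<le> D * card (core F D)" by simp
    moreover have "2 * card F \<ge> D * card (core F D)" using core_degree_sum[OF 0(1)] by simp
    ultimately have "D + 1 \<le> card F" by linarith
    then show ?thesis by simp
  qed
next
  case (Suc m)
  show ?case
  proof (cases "\<exists>v. card (nb F v) \<ge> D + 1")
    case True
    then obtain v where v: "card (nb F v) \<ge> D + 1" by auto
    have "\<not> kill (del F {v}) m" using kill_del[of F v m] Suc.prems(2) by blast
    then have "(m + 1) * (D + 1) \<le> card (del F {v})" using Suc.IH[OF finite_simple_graph_del[OF Suc.prems(1)]] by blast
    then show ?thesis using v card_del[OF Suc.prems(1), of v] by simp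
  next
    case False
    then have dg: "card (nb F v) \<le> D" for v by (metis Suc_eq_plus1 not_less_eq_eq)
    then have D2: "D \<ge> 2" using small_degree_good[OF Suc.prems(1)] good_imp_kill Suc.prems(2) by force
    have "3 * (m + 2) \<le> card (core F D)" using core_bound_3[OF Suc.prems(1) dg Suc.prems(2)] by simp
    then have "D * (3 * (m + 2)) \<le> D * card (core F D)" by (rule mult_le_mono2)
    moreover have "2 * card F \<ge> D * card (core F D)" using core_degree_sum[OF Suc.prems(1)] by simp
    moreover have "2 * (m + 2) \<le> D * (m + 2)" using D2 by (rule mult_le_mono1)
    ultimately show ?thesis by (simp add: algebra_simps)
  qed
qed

end

section \<open>Components of tight graphs\<close>

definition four_cycle :: "'v \<Rightarrow> 'v \<Rightarrow> 'v \<Rightarrow> 'v \<Rightarrow> 'v graph" where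
  "four_cycle p q r s = {{p, q}, {q, r}, {r, s}, {s, p}}"

lemma nb_star_on: "v \<notin> L \<Longrightarrow> nb (star_on v L) x = (if x = v then L else if x \<in> L then {v} else {})"
  by (auto simp: nb_def star_on_def doubleton_eq_iff)

lemma nb_nsets: "nb (nsets W 2) x = (if x \<in> W then W - {x} else {})"
  by (auto simp: nb_def nsets_def card_2_iff doubleton_eq_iff)

lemma nb_four_cycle:
  assumes "distinct [p, q, r, s]"
  shows "nb (four_cycle p q r s) p = {q, s}" "nb (four_cycle p q r s) q = {p, r}"
    "nb (four_cycle p q r s) r = {q, s}" "nb (four_cycle p q r s) s = {p, r}"
  using assms by (auto simp: nb_def four_cycle_def doubleton_eq_iff)

lemma Union_star_on: "L \<noteq> {} \<Longrightarrow> \<Union>(star_on v L) = insert v L"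
  by (auto simp: star_on_def)

lemma Union_nsets_2: "card W \<ge> 2 \<Longrightarrow> \<Union>(nsets W 2) = W"
proof
  assume W: "card W \<ge> 2"
  show "W \<subseteq> \<Union>(nsets W 2)"
  proof
    fix x assume "x \<in> W"
    then have "card (W - {x}) \<noteq> 0" using W by simp
    then have "W - {x} \<noteq> {}" by force
    then obtain y where "y \<in> W" "y \<noteq> x" by blast
    then have "{x, y} \<in> nsets W 2" using \<open>x \<in> W\<close> by (auto simp: nsets_def)
    then show "x \<in> \<Union>(nsets W 2)" by blast
  qed
qed (auto simp: nsets_def)

lemma Union_four_cycle: "\<Union>(four_cycle p q r s) = {p, q, r, s}"
  by (auto simp: four_cycle_def)

lemma finite_simple_star_on: "finite L \<Longrightarrow> v \<notin> L \<Longrightarrow> finite_simple_graph (star_on v L)"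
  by (auto simp: finite_simple_graph_def star_on_def card_2_iff)

lemma finite_simple_nsets: "finite W \<Longrightarrow> finite_simple_graph (nsets W 2)"
  by (auto simp: finite_simple_graph_def finite_imp_finite_nsets) (auto simp: nsets_def)

lemma finite_simple_four_cycle: "distinct [p, q, r, s] \<Longrightarrow> finite_simple_graph (four_cycle p q r s)"
  by (auto simp: finite_simple_graph_def four_cycle_def)

lemma card_star_on: "v \<notin> L \<Longrightarrow> card (star_on v L) = card L"
  unfolding star_on_def by (rule card_image) (auto simp: inj_on_def doubleton_eq_iff)

lemma card_four_cycle: "distinct [p, q, r, s] \<Longrightarrow> card (four_cycle p q r s) = 4"
  by (auto simp: four_cycle_def card_insert_if doubleton_eq_iff)

lemma finite_simple_graph_Un:
  "finite_simple_graph F \<Longrightarrow> finite_simple_graph F' \<Longrightarrow> finite_simple_graph (F \<union> F')"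
  by (auto simp: finite_simple_graph_def)

lemma nb_disjoint:
  assumes "\<Union>F \<inter> \<Union>C = {}" "u \<in> \<Union>C" shows "nb (F \<union> C) u = nb C u"
  using assms by (auto simp: nb_def)

lemma card_disjoint_graphs:
  assumes "finite_simple_graph F" "finite_simple_graph C" "\<Union>F \<inter> \<Union>C = {}"
  shows "card (F \<union> C) = card F + card C"
proof (rule card_Un_disjoint)
  show "F \<inter> C = {}"
  proof (rule ccontr)
    assume "F \<inter> C \<noteq> {}"
    then obtain e where e: "e \<in> F" "e \<in> C" by auto
    then have "e \<noteq> {}" using assms(1) by (auto simp: finite_simple_graph_def)
    then show False using e assms(3) by blast
  qed
qed (use assms in \<open>auto simp: finite_simple_graph_def\<close>)

text \<open>Every vertex of a critical subgraph has two neighbours, so there is a path z, x, v, y;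
  its ends differ because there is no triangle. The value 4 replaces the 3 of the general core
  bound.\<close>

lemma triangle_free_critical:
  assumes fs: "finite_simple_graph F" and tf: "\<And>x y z. {x, y} \<in> F \<Longrightarrow> {y, z} \<in> F \<Longrightarrow> {x, z} \<notin> F"
    and dg: "\<And>v. card (nb F v) \<le> 2" and nc: "\<not> colourable F 2"
  shows "card (core F 2) \<ge> 4"
proof -
  obtain F' where F': "F' \<subseteq> F" "F' \<noteq> {}"
    and F'v: "\<And>v. v \<in> \<Union>F' \<Longrightarrow> card {u \<in> nb F' v. card (nb F' u) = 2} \<ge> 2"
    using not_colourable_critical[OF fs dg nc] by blast
  have fs': "finite_simple_graph F'" using finite_simple_graph_subset[OF fs F'(1)] .
  have d2: "card (nb F' v) \<ge> 2" if "v \<in> \<Union>F'" for v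
    using F'v[OF that] card_mono[OF finite_nb[OF fs', of v], of "{u \<in> nb F' v. card (nb F' u) = 2}"] by auto
  have core: "v \<in> core F 2" if v: "v \<in> \<Union>F'" for v
    using d2[OF v] dg[of v] card_mono[OF finite_nb[OF fs] nb_mono[OF F'(1)], of v] v F'(1)
    by (auto simp: core_def)
  have two: "\<exists>y\<in>nb F' v. y \<noteq> x" if "v \<in> \<Union>F'" for v x
  proof (rule ccontr)
    assume "\<not> ?thesis"
    then have "nb F' v \<subseteq> {x}" by blast
    then have "card (nb F' v) \<le> 1" using card_mono[of "{x}" "nb F' v"] by simp
    then show False using d2[OF that] by simp
  qed
  obtain e where "e \<in> F'" using F'(2) by blast
  moreover from this have "e \<noteq> {}" using fs' by (auto simp: finite_simple_graph_def)
  ultimately obtain v where v: "v \<in> \<Union>F'" by blast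
  obtain x where x: "x \<in> nb F' v" using two[OF v] by blast
  obtain y where y: "y \<in> nb F' v" "y \<noteq> x" using two[OF v] by blast
  have xF: "x \<in> \<Union>F'" "y \<in> \<Union>F'" using x y nb_subset_vertices[of F' v] by auto
  obtain z where z: "z \<in> nb F' x" "z \<noteq> v" using two[OF xF(1)] by blast
  have zF: "z \<in> \<Union>F'" using z nb_subset_vertices[of F' x] by auto
  have "z \<noteq> y"
  proof
    assume "z = y"
    then have "{v, x} \<in> F" "{x, y} \<in> F" "{v, y} \<in> F" using x y z F'(1) by (auto simp: in_nb)
    then show False using tf by blast
  qed
  moreover have "v \<noteq> x" "v \<noteq> y" "z \<noteq> x" using x y z nb_not_self[OF fs'] by blast+
  ultimately have "card {v, x, y, z} = 4" using y z by auto
  moreover have "{v, x, y, z} \<subseteq> core F 2" using core v xF zF by blast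
  ultimately show ?thesis using card_mono[OF finite_core[OF fs], of "{v, x, y, z}" 2] by simp
qed

section \<open>Extremal graphs of small degree, and the four component types\<close>

context star_ramsey
begin

text \<open>If the total excess 2 is not split between two colours, one colour has
  \<open>b s\<close> at least 3 and can take every edge.\<close>

lemma not_exc_good:
  assumes fs: "finite_simple_graph F" and dg: "\<And>v. card (nb F v) \<le> 2" and D: "D = 2" "\<not> exc"
  shows "good F"
proof -
  have "\<exists>s\<in>{1..t}. b s \<ge> 3"
  proof (rule ccontr)
    assume no: "\<not> ?thesis"
    have "\<exists>r\<in>{1..t}. b r - 1 \<noteq> 0"
      using D(1) unfolding D_def by (metis (no_types, lifting) sum.neutral zero_neq_numeral)
    then obtain r where r: "r \<in> {1..t}" "b r = 2" using no by force
    have "(\<Sum>s\<in>{1..t} - {r}. b s - 1) = 1"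
      using D(1) r sum.remove[of "{1..t}" r "\<lambda>s. b s - 1"] by (simp add: D_def)
    then have "\<exists>s\<in>{1..t} - {r}. b s - 1 \<noteq> 0" by (metis (no_types, lifting) sum.neutral zero_neq_one)
    then obtain s where s: "s \<in> {1..t}" "s \<noteq> r" "b s = 2" using no by force
    then show False using D(2) r unfolding exc_def using D(1) by blast
  qed
  then obtain s where s: "s \<in> {1..t}" "b s \<ge> 3" by blast
  have "card {e \<in> F. v \<in> e \<and> s = r} < b r" if r: "r \<in> {1..t}" for v r
  proof (cases "s = r")
    case True
    then have "card {e \<in> F. v \<in> e \<and> s = r} = card (nb F v)" using card_incident[OF fs, of v] by simp
    then show ?thesis using dg[of v] s True by simp
  next
    case False
    then show ?thesis using b_pos[OF r] by simp
  qed
  then show ?thesis unfolding good_def using s by (intro exI[of _ "\<lambda>_. s"]) auto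
qed

text \<open>Equality in the degree count makes every degree 2, so any triangle is a whole component;
  a graph without triangles would have too large a core.\<close>

lemma triangle_component:
  assumes fs: "finite_simple_graph F" and card: "card F = n * (D + 1)" and n: "n \<ge> 1"
    and nk: "\<not> kill F (n - 1)" and dg: "\<And>v. card (nb F v) \<le> D"
  shows "exc \<and> (\<exists>W. card W = 3 \<and> nsets W 2 \<subseteq> F \<and> (\<forall>e\<in>F. e \<inter> W \<noteq> {} \<longrightarrow> e \<in> nsets W 2))"
proof -
  have ng: "\<not> good F" using nk good_imp_kill by blast
  have D2: "D \<ge> 2" using small_degree_good[OF fs dg] ng by force
  have c3: "3 * n \<le> card (core F D)" using core_bound_3[OF fs dg nk] n by simp
  note ds = core_degree_sum[OF fs, unfolded card]
  \<comment> \<open>The count 3nD <= 2 \<open>card F\<close> = 2n(D + 1) leaves only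
    \<open>D\<close> = 2. Both sides are then equal, so there are no vertices outside the
    core.\<close>
  have "D * (3 * n) \<le> D * card (core F D)" using c3 by (rule mult_le_mono2)
  moreover have "D * (3 * n) = 3 * (n * D)" "n * (D + 1) = n * D + n" by simp_all
  ultimately have "n * D \<le> n * 2" using ds by linarith
  then have D: "D = 2" using D2 n by simp
  have zero: "(\<Sum>v\<in>\<Union>F - core F D. card (nb F v)) = 0" and c3': "card (core F D) = 3 * n"
    using ds c3 D by simp_all
  have all2: "card (nb F v) = 2" if "v \<in> \<Union>F" for v
  proof (cases "v \<in> core F D")
    case False
    then have "card (nb F v) = 0" using zero that finite_vertices[OF fs] by simp
    then have "nb F v = {}" using finite_nb[OF fs] by simp
    then show ?thesis using vertex_iff_nb[OF fs] that by blast
  qed (simp add: core_def D)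
  have exc: "exc" using not_exc_good[OF fs dg[unfolded D] D] ng by blast
  have "\<exists>x y z. {x, y} \<in> F \<and> {y, z} \<in> F \<and> {x, z} \<in> F"
  proof (rule ccontr)
    assume no: "\<not> ?thesis"
    \<comment> \<open>Starting \<open>core_bound\<close> from 4 instead of 3 gives 3n + 1 core
      vertices, one more than there are.\<close>
    have "3 * (n - 1) + 4 \<le> card (core F D)"
    proof (rule core_bound[OF fs dg nk])
      fix F' assume F': "F' \<subseteq> F" "\<not> good F'"
      have fs': "finite_simple_graph F'" using finite_simple_graph_subset[OF fs F'(1)] .
      have "card (nb F' v) \<le> 2" for v
        using dg[of v] card_mono[OF finite_nb[OF fs] nb_mono[OF F'(1)], of v] D by linarith
      moreover have "{x, y} \<in> F' \<Longrightarrow> {y, z} \<in> F' \<Longrightarrow> {x, z} \<notin> F'" for x y z using no F'(1) by blast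
      moreover have "\<not> colourable F' 2" using colourable_imp_good[OF fs'] F'(2) D by auto
      ultimately show "4 \<le> card (core F' D)" unfolding D by (intro triangle_free_critical[OF fs'])
    qed
    then show False using c3' n by simp
  qed
  then obtain x y z where e: "{x, y} \<in> F" "{y, z} \<in> F" "{x, z} \<in> F" by blast
  have ne: "x \<noteq> y" "y \<noteq> z" "x \<noteq> z" using e fs by (auto simp: finite_simple_graph_def)
  have nbs: "nb F x = {y, z}" "nb F y = {x, z}" "nb F z = {x, y}"
    using e ne all2[of x] all2[of y] all2[of z] finite_nb[OF fs]
    by (intro card_subset_eq[symmetric]; force simp: in_nb insert_commute)+
  define W where "W = {x, y, z}"
  have sub: "nsets W 2 \<subseteq> F"
    using e by (auto simp: W_def nsets_def card_2_iff insert_commute)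
  have cl: "e \<in> nsets W 2" if e: "e \<in> F" "e \<inter> W \<noteq> {}" for e
  proof -
    obtain v where v: "v \<in> e" "v \<in> W" using e by blast
    obtain u where u: "u \<noteq> v" "e = {v, u}" using simple_edgeE[OF fs e(1) v(1)] by blast
    then have "u \<in> nb F v" using e by (simp add: in_nb)
    then have "u \<in> W" using v(2) nbs by (auto simp: W_def)
    then show ?thesis using u v by (auto simp: nsets_def)
  qed
  show ?thesis using exc sub cl ne by (intro conjI exI[of _ W]) (auto simp: W_def)
qed

text \<open>These are the building blocks of extremal graphs. In units of \<open>D + 1\<close>
  edges, the star and \<open>K_3\<close> have weight 1, while \<open>C_4\<close> and
  \<open>K_4\<close> have weight 2.\<close>

definition component :: "'v graph \<Rightarrow> bool" where
  "component C \<longleftrightarrow>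
     (\<exists>v L. v \<notin> L \<and> finite L \<and> card L = D + 1 \<and> C = star_on v L) \<or>
     D = 1 \<and> (\<exists>p q r s. distinct [p, q, r, s] \<and> C = four_cycle p q r s) \<or>
     exc \<and> (\<exists>W. (card W = 3 \<or> card W = 4) \<and> C = nsets W 2)"

lemma component_cases [consumes 1, case_names Star Cycle Triangle K4]:
  assumes "component C"
  obtains v L where "v \<notin> L" "finite L" "card L = D + 1" "C = star_on v L"
  | p q r s where "D = 1" "distinct [p, q, r, s]" "C = four_cycle p q r s"
  | W where "exc" "D = 2" "finite W" "card W = 3" "C = nsets W 2"
  | W where "exc" "D = 2" "finite W" "card W = 4" "C = nsets W 2"
proof -
  have "finite W" if "card W = 3 \<or> card W = 4" for W :: "'a set"
    using that by (intro card_ge_0_finite) auto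
  then show ?thesis using assms that unfolding component_def by (metis exc_def)
qed

lemma component_simple: "component C \<Longrightarrow> finite_simple_graph C"
  by (cases rule: component_cases)
    (auto simp: finite_simple_star_on finite_simple_four_cycle finite_simple_nsets)

lemma single_edge_good:
  assumes "D \<ge> 1" "card F \<le> 1" "finite_simple_graph F" shows "good F"
proof (rule colourable_imp_good[OF assms(3)])
  have "finite F" using assms(3) by (simp add: finite_simple_graph_def)
  then have "\<And>e e'. e \<in> F \<Longrightarrow> e' \<in> F \<Longrightarrow> e = e'" using assms(2) by (simp add: card_le_Suc0_iff_eq)
  then show "colourable F D" using assms(1) unfolding colourable_def proper_colouring_def
    by (intro exI[of _ "\<lambda>_. 0"]) auto
qed

text \<open>The number \<open>w\<close> is the weight. The deleted vertices are the centre of a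
  star, two opposite vertices of \<open>C_4\<close>, one vertex of \<open>K_3\<close>, or two of
  \<open>K_4\<close>; the complete graphs leave a single edge, which is good because
  \<open>D\<close> is positive.\<close>

lemma component_kill:
  assumes "component C"
  shows "\<exists>w\<ge>1. card C = w * (D + 1) \<and> kill C w"
  using assms
proof (cases rule: component_cases)
  case (Star v L)
  have "del C {v} = {}" using Star by (auto simp: del_def star_on_def)
  then have "kill C 1" using good_empty unfolding kill_def by (intro exI[of _ "{v}"]) auto
  then show ?thesis using Star card_star_on[of v L] by (intro exI[of _ 1]) auto
next
  case (Cycle p q r s)
  have "del C {p, r} = {}" using Cycle by (auto simp: del_def four_cycle_def)
  then have "kill C 2" using good_empty unfolding kill_def
    by (intro exI[of _ "{p, r}"]) (auto simp: card_insert_if)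
  then show ?thesis using Cycle card_four_cycle[of p q r s] by (intro exI[of _ 2]) auto
next
  case (Triangle W)
  then obtain x where x: "x \<in> W" by fastforce
  have "del C {x} = nsets (W - {x}) 2" using Triangle by (auto simp: del_def nsets_def)
  moreover have "card (nsets (W - {x}) 2) = 1" using Triangle x by (simp add: card_nsets)
  ultimately have "good (del C {x})" using Triangle by (intro single_edge_good) (auto simp: finite_simple_nsets)
  then have "kill C 1" unfolding kill_def by (intro exI[of _ "{x}"]) auto
  moreover have "card C = 3" using Triangle by (simp add: card_nsets choose_two)
  ultimately show ?thesis using Triangle by (intro exI[of _ 1]) auto
next
  case (K4 W)
  then obtain X where X: "X \<subseteq> W" "card X = 2" using obtain_subset_with_card_n[of 2 W] by auto
  have fX: "finite X" using X K4 finite_subset by blast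
  have "del C X = nsets (W - X) 2" using K4 by (auto simp: del_def nsets_def)
  moreover have "card (nsets (W - X) 2) = 1" using K4 X fX by (simp add: card_nsets card_Diff_subset)
  ultimately have "good (del C X)" using K4 by (intro single_edge_good) (auto simp: finite_simple_nsets)
  then have "kill C 2" unfolding kill_def using X fX by (intro exI[of _ X]) auto
  moreover have "card C = 6" using K4 by (simp add: card_nsets choose_two)
  ultimately show ?thesis using K4 by (intro exI[of _ 2]) auto
qed

inductive nice :: "'v graph \<Rightarrow> bool" where
  empty: "nice {}"
| add: "nice F \<Longrightarrow> component C \<Longrightarrow> \<Union>F \<inter> \<Union>C = {} \<Longrightarrow> nice (F \<union> C)"

lemma nice_simple: "nice F \<Longrightarrow> finite_simple_graph F"
proof (induction rule: nice.induct)
  case empty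
  then show ?case by (simp add: finite_simple_graph_def)
next
  case (add F C)
  then show ?case using finite_simple_graph_Un component_simple by blast
qed

text \<open>The converse of the lower bound for these graphs: weights add up over components, both
  in edges and in deletions.\<close>

lemma nice_kill: "nice F \<Longrightarrow> \<exists>k. card F = k * (D + 1) \<and> kill F k"
proof (induction rule: nice.induct)
  case empty
  then show ?case using good_empty good_imp_kill by (intro exI[of _ 0]) auto
next
  case (add F C)
  have fs: "finite_simple_graph F" "finite_simple_graph C" using add nice_simple component_simple by auto
  obtain k w where "card F = k * (D + 1)" "kill F k" "card C = w * (D + 1)" "kill C w"
    using add component_kill by blast
  then have "card (F \<union> C) = (k + w) * (D + 1)" "kill (F \<union> C) (k + w)"
    using card_disjoint_graphs[OF fs add.hyps(3)] kill_Un[OF _ _ add.hyps(3)] fs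
    by (auto simp: algebra_simps finite_simple_graph_def)
  then show ?case by blast
qed

lemma nice_component_of:
  assumes "nice F" "u \<in> \<Union>F"
  shows "\<exists>F' C. F = F' \<union> C \<and> nice F' \<and> component C \<and> \<Union>F' \<inter> \<Union>C = {} \<and> u \<in> \<Union>C"
  using assms
proof (induction rule: nice.induct)
  case (add F C)
  show ?case
  proof (cases "u \<in> \<Union>C")
    case True
    then show ?thesis using add by blast
  next
    case False
    then obtain F' C' where F': "F = F' \<union> C'" "nice F'" "component C'" "\<Union>F' \<inter> \<Union>C' = {}" "u \<in> \<Union>C'"
      using add by blast
    have "nice (F' \<union> C)" using F' add by (intro nice.add) auto
    then show ?thesis using F' add by (intro exI[of _ "F' \<union> C"] exI[of _ C']) auto
  qed
qed simp

text \<open>A list of possible neighbourhoods, so that a nice graph can be contradicted by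
  inspecting one vertex without naming its component.\<close>

lemma nice_local [consumes 2, case_names Centre Leaf Cycle Triangle K4]:
  assumes "nice F" "u \<in> \<Union>F"
  obtains "card (nb F u) = D + 1" "\<And>w. w \<in> nb F u \<Longrightarrow> nb F w = {u}"
  | c where "nb F u = {c}" "card (nb F c) = D + 1"
  | q r s where "D = 1" "q \<noteq> s" "u \<noteq> r" "nb F u = {q, s}" "nb F q = {u, r}" "nb F s = {u, r}" "nb F r = {q, s}"
  | x y where "D = 2" "exc" "x \<noteq> y" "nb F u = {x, y}" "nb F x = {u, y}" "nb F y = {u, x}"
  | "D = 2" "exc" "card (nb F u) = 3" "\<And>w. w \<in> nb F u \<Longrightarrow> card (nb F w) = 3"
proof -
  obtain F' C where F: "F = F' \<union> C" "component C" "\<Union>F' \<inter> \<Union>C = {}" "u \<in> \<Union>C"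
    using nice_component_of[OF assms] by blast
  have nbC: "nb F w = nb C w" if "w \<in> \<Union>C" for w using nb_disjoint[OF F(3) that] F(1) by simp
  note thms = that
  show ?thesis
    using F(2)
  proof (cases rule: component_cases)
    case (Star v L)
    then have L: "L \<noteq> {}" by auto
    note V = Union_star_on[OF L, of v, folded Star(4)] and N = nb_star_on[OF Star(1), folded Star(4)]
    show ?thesis
    proof (cases "u = v")
      case True
      have uL: "nb F u = L" using nbC[of u] N[of u] V True by simp
      show ?thesis
      proof (rule thms(1))
        show "card (nb F u) = D + 1" using uL Star by simp
        show "nb F w = {u}" if "w \<in> nb F u" for w
          using that uL nbC[of w] N[of w] V Star(1) True by auto
      qed
    next
      case False
      then have "u \<in> L" using F(4) V by auto
      then have "nb F u = {v}" "nb F v = L" using nbC N V False by auto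
      then show ?thesis using thms(2)[of v] Star by auto
    qed
  next
    case (Cycle p q r s)
    note V = Union_four_cycle[of p q r s, folded Cycle(3)] and N = nb_four_cycle[OF Cycle(2), folded Cycle(3)]
    have N': "nb F p = {q, s}" "nb F q = {p, r}" "nb F r = {q, s}" "nb F s = {p, r}"
      using nbC N V by auto
    consider "u = p" | "u = q" | "u = r" | "u = s" using F(4) V by blast
    then show ?thesis
    proof cases
      case 1
      then show ?thesis using thms(3)[of q s r] Cycle N' by auto
    next
      case 2
      then show ?thesis using thms(3)[of p r s] Cycle N' by (auto simp: insert_commute)
    next
      case 3
      then show ?thesis using thms(3)[of q s p] Cycle N' by (auto simp: insert_commute)
    next
      case 4
      then show ?thesis using thms(3)[of p r q] Cycle N' by (auto simp: insert_commute)
    qed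
  next
    case (Triangle W)
    have V: "\<Union>C = W" using Union_nsets_2[of W] Triangle by simp
    then have uW: "u \<in> W" using F(4) by simp
    then have "card (W - {u}) = 2" using Triangle by simp
    then obtain x y where xy: "W - {u} = {x, y}" "x \<noteq> y" by (auto simp: card_2_iff)
    have W: "W = {u, x, y}" "u \<noteq> x" "u \<noteq> y" using uW xy(1) by auto
    have "nb F w = W - {w}" if "w \<in> W" for w
      using nbC[of w] V nb_nsets[of W, folded Triangle(5)] that by simp
    then have "nb F u = {x, y}" "nb F x = {u, y}" "nb F y = {u, x}" using W xy(2) by auto
    then show ?thesis using thms(4)[of x y] Triangle(1,2) xy(2) by blast
  next
    case (K4 W)
    have V: "\<Union>C = W" using Union_nsets_2[of W] K4 by simp
    have "nb F w = W - {w}" if "w \<in> W" for w using nbC V nb_nsets[of W, folded K4(5)] that by simp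
    then have "card (nb F w) = 3" if "w \<in> W" for w using that K4 by simp
    moreover have "u \<in> W" "nb F u \<subseteq> W" using F(4) V nbC[of u] nb_subset_vertices[of C u] by auto
    ultimately show ?thesis using thms(5)[OF K4(2,1)] by blast
  qed
qed

end

section \<open>The structure of tight graphs\<close>

context star_ramsey
begin

text \<open>The case of equality in \<open>card_lower_bound\<close> with
  \<open>m = n - 1\<close>.\<close>

definition tight :: "'v graph \<Rightarrow> nat \<Rightarrow> bool" where
  "tight F n \<longleftrightarrow> finite_simple_graph F \<and> n \<ge> 1 \<and> card F = n * (D + 1) \<and> \<not> kill F (n - 1)"

text \<open>A component of weight \<open>w\<close> accounts for \<open>w\<close> deletions and for
  \<open>w\<close> units of edges, so equality passes to the rest with \<open>n - w\<close>. An
  empty rest is listed apart because \<open>tight\<close> demands a positive parameter.\<close>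

lemma tight_remove_component:
  assumes T: "tight (F \<union> C) n" and C: "component C" and dis: "\<Union>F \<inter> \<Union>C = {}"
  shows "F = {} \<or> (\<exists>m<n. tight F m)"
proof (cases "F = {}")
  case False
  have fs: "finite_simple_graph F" "finite_simple_graph C"
    using T finite_simple_graph_subset[of "F \<union> C"] by (auto simp: tight_def)
  then have fin: "finite F" "finite C" by (auto simp: finite_simple_graph_def)
  obtain w where w: "w \<ge> 1" "card C = w * (D + 1)" "kill C w" using component_kill[OF C] by blast
  have card: "card F + w * (D + 1) = n * (D + 1)"
    using card_disjoint_graphs[OF fs dis] T w by (simp add: tight_def)
  moreover have "card F > 0" using False fin by (simp add: card_gt_0_iff)
  ultimately have "w * (D + 1) < n * (D + 1)" by linarith
  then have wn: "w < n" using mult_less_cancel2 by blast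
  have "(n - w) * (D + 1) + w * (D + 1) = n * (D + 1)" using wn unfolding distrib_right[symmetric] by simp
  then have "card F = (n - w) * (D + 1)" using card by linarith
  moreover have "\<not> kill F (n - w - 1)"
  proof
    assume "kill F (n - w - 1)"
    then have "kill (F \<union> C) (n - w - 1 + w)" using kill_Un[OF _ w(3) dis fin] by blast
    then show False using T wn by (simp add: tight_def)
  qed
  ultimately have "tight F (n - w)" using fs wn by (simp add: tight_def)
  then show ?thesis using w wn by (intro disjI2 exI[of _ "n - w"]) auto
qed simp

text \<open>What remains still resists \<open>n - 2\<close> deletions, hence has at least (n - 1)(D
  + 1) edges. This leaves exactly \<open>D + 1\<close> edges for \<open>v\<close> and equality for
  the remainder.\<close>

lemma tight_del:
  assumes T: "tight F n" and n: "n \<ge> 2" and v: "card (nb F v) \<ge> D + 1"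
  shows "card (nb F v) = D + 1" and "tight (del F {v}) (n - 1)"
proof -
  have fs: "finite_simple_graph F" "finite_simple_graph (del F {v})"
    using T finite_simple_graph_del by (auto simp: tight_def)
  have "Suc (n - 2) = n - 1" using n by simp
  then have nk: "\<not> kill (del F {v}) (n - 2)"
    using T kill_del[of F v "n - 2"] by (auto simp: tight_def)
  then have lb: "(n - 2 + 1) * (D + 1) \<le> card (del F {v})" by (rule card_lower_bound[OF fs(2)])
  have "n * (D + 1) = ((n - 2 + 1) + 1) * (D + 1)" by (rule arg_cong2[where f = "(*)"]) (use n in simp_all)
  then have "n * (D + 1) = (n - 2 + 1) * (D + 1) + (D + 1)" by (simp only: distrib_right mult_1)
  moreover have "n * (D + 1) = card (nb F v) + card (del F {v})" using card_del[OF fs(1), of v] T by (simp add: tight_def)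
  ultimately have 1: "card (nb F v) = D + 1" and 2: "card (del F {v}) = (n - 2 + 1) * (D + 1)"
    using lb v by linarith+
  show "card (nb F v) = D + 1" by (rule 1)
  have "n - 2 + 1 = n - 1" "n - 1 - 1 = n - 2" using n by auto
  then show "tight (del F {v}) (n - 1)" using fs(2) 2 nk n unfolding tight_def by simp
qed

text \<open>Deleting any vertex of degree \<open>D + 1\<close> leaves a nice graph by induction. The
  proof fixes one such vertex \<open>v\<close>, examines how it is attached to the rest
  \<open>H\<close>, and deletes a second vertex whenever the attachment is not one of the allowed
  ones.\<close>

lemma tight_imp_nice: "tight F n \<Longrightarrow> nice F"
proof (induction n arbitrary: F rule: less_induct)
  case (less n)
  note T = less.prems
  have fs: "finite_simple_graph F" and n: "n \<ge> 1" and card: "card F = n * (D + 1)" and nk: "\<not> kill F (n - 1)"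
    using T by (auto simp: tight_def)
  \<comment> \<open>By induction it suffices to split off a single component of
    \<open>F\<close>.\<close>
  have split: "nice F" if s: "F = F' \<union> C" "component C" "\<Union>F' \<inter> \<Union>C = {}" for F' C
  proof -
    have "nice F'" using tight_remove_component[OF T[unfolded s(1)] s(2,3)] less.IH nice.empty by metis
    then show ?thesis using s nice.add by blast
  qed
  show ?case
  proof (cases "\<exists>v. card (nb F v) \<ge> D + 1")
    case False
    then have small: "card (nb F v) \<le> D" for v by (metis Suc_eq_plus1 not_less_eq_eq)
    obtain W where W: "exc" "card W = 3" "nsets W 2 \<subseteq> F" "\<And>e. e \<in> F \<Longrightarrow> e \<inter> W \<noteq> {} \<Longrightarrow> e \<in> nsets W 2"
      using triangle_component[OF fs card n nk small] by blast
    have "component (nsets W 2)" using W by (auto simp: component_def)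
    moreover have "\<Union>(F - nsets W 2) \<inter> \<Union>(nsets W 2) = {}" using W Union_nsets_2[of W] by fastforce
    moreover have "F = (F - nsets W 2) \<union> nsets W 2" using W by blast
    ultimately show ?thesis using split by blast
  next
    case True
    then obtain v where v: "card (nb F v) \<ge> D + 1" by blast
    define P where "P = nb F v"
    define H where "H = del F {v}"
    have finP: "finite P" and vP: "v \<notin> P" using finite_nb[OF fs] nb_not_self[OF fs] by (auto simp: P_def)
    have FH: "F = H \<union> star_on v P"
      using incident_eq_image[OF fs, of v] by (auto simp: H_def P_def star_on_def del_def)
    have vH: "v \<notin> \<Union>H" by (auto simp: H_def del_def)
    show ?thesis
    proof (cases "n = 1")
      case True
      then have "card H = 0" "card P = D + 1" using card_del[OF fs, of v] v card by (auto simp: H_def P_def)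
      moreover have "finite H" using finite_simple_graph_del[OF fs] by (auto simp: H_def finite_simple_graph_def)
      ultimately have "F = {} \<union> star_on v P" "component (star_on v P)"
        using FH finP vP by (auto simp: component_def)
      then show ?thesis using nice.add[OF nice.empty] by fastforce
    next
      case False
      then have n2: "n \<ge> 2" using n by simp
      note td = tight_del[OF T n2]
      have dg: "card (nb F u) \<le> D + 1" for u using td(1)[of u] by linarith
      have delnice: "nice (del F {u})" if "card (nb F u) \<ge> D + 1" for u
        using less.IH[OF _ td(2)[OF that]] n2 by simp
      have Hn: "nice H" using delnice[OF v] by (simp add: H_def)
      have cP: "card P = D + 1" using td(1)[OF v] by (simp add: P_def)
      then have P0: "P \<noteq> {}" by auto
      have starP: "component (star_on v P)" "\<Union>(star_on v P) = insert v P"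
        using vP finP cP Union_star_on[OF P0] by (auto simp: component_def)
      have nbF: "nb F u = nb H u \<union> (if u \<in> P then {v} else {})" if "u \<noteq> v" for u
        using that nb_commute[of v F u] by (auto simp: H_def P_def nb_del)
      \<comment> \<open>A neighbour of \<open>v\<close> has one more edge in \<open>F\<close> than
        in \<open>H\<close>, and degrees in \<open>F\<close> are at most
        \<open>D + 1\<close>.\<close>
      have nbH_P: "card (nb H u) \<le> D" if u: "u \<in> P" for u
      proof -
        have "u \<noteq> v" using u vP by auto
        moreover have "v \<notin> nb H u" using nb_subset_vertices[of H u] vH by auto
        ultimately have "card (nb F u) = card (nb H u) + 1" using nbF[of u] u finite_nb[OF nice_simple[OF Hn]] by simp
        then show ?thesis using dg[of u] by simp
      qed
      \<comment> \<open>If \<open>v\<close> is attached to a triangle of \<open>H\<close>, it is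
        attached to all three vertices and to nothing else, so the triangle and \<open>v\<close>
        form a \<open>K_4\<close> component.\<close>
      have triangle: "nice F" if l: "l \<in> P" "l \<in> W" and H: "H = F' \<union> nsets W 2" "nice F'" "\<Union>F' \<inter> \<Union>(nsets W 2) = {}"
        and W: "exc" "finite W" "card W = 3" for l W F'
      proof -
        have D2: "D = 2" using W by (simp add: exc_def)
        have UW: "\<Union>(nsets W 2) = W" using Union_nsets_2[of W] W by simp
        have nbH: "nb H u = W - {u}" if "u \<in> W" for u
          using nb_disjoint[OF H(3), of u] UW nb_nsets[of W u] that H(1) by simp
        have vW: "v \<notin> W" using vH H(1) UW by auto
        have "l \<noteq> v" using l vW by auto
        then have nbl: "nb F l = insert v (W - {l})" using nbF[of l] nbH l by auto
        then have "card (nb F l) \<ge> D + 1" using W l vW D2 by simp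
        then have n3: "nice (del F {l})" by (rule delnice)
        define H2 where "H2 = del F {l}"
        have fsH2: "finite_simple_graph H2" using nice_simple n3 by (simp add: H2_def)
        \<comment> \<open>Here \<open>l\<close> has degree 3 and may be deleted instead. A vertex
          \<open>x\<close> of the triangle not adjacent to \<open>v\<close> would then be a leaf
          attached to \<open>y\<close>, whose degree is at most 2 rather than the 3 of a star
          centre.\<close>
        have "x \<in> P" if x: "x \<in> W" for x
        proof (rule ccontr)
          assume xP: "x \<notin> P"
          then have xl: "x \<noteq> l" using l by auto
          have xv: "x \<noteq> v" using vW x by auto
          have "card (W - {x} - {l}) = 1" using W x l xl by simp
          then obtain y where y: "W - {x} - {l} = {y}" by (auto simp: card_1_singleton_iff)
          have nbx: "nb H2 x = {y}"
            using xl xv xP nbF[of x] nbH[OF x] y by (auto simp: H2_def nb_del)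
          have yW: "y \<in> W" "y \<noteq> x" "y \<noteq> l" "y \<noteq> v" using y vW by auto
          have "nb H2 y \<subseteq> insert v (W - {y} - {l})"
            using nbF[of y] nbH[OF yW(1)] yW by (auto simp: H2_def nb_del)
          also have "W - {y} - {l} = {x}" using y yW x xl by auto
          finally have "card (nb H2 y) \<le> card {v, x}" by (intro card_mono) auto
          also have "\<dots> \<le> 2" by (simp add: card_insert_if)
          finally have cy: "card (nb H2 y) \<le> 2" .
          have "x \<in> \<Union>H2" using vertex_iff_nb[OF fsH2] nbx by blast
          with n3[folded H2_def] show False
          proof (cases rule: nice_local)
            case (Leaf c)
            then show False using nbx cy D2 by auto
          next
            case (Triangle p q)
            then show False using nbx by auto
          qed (use nbx D2 in auto)
        qed
        then have "W \<subseteq> P" by blast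
        then have PW: "P = W" using card_subset_eq[OF finP, of W] cP W D2 by simp
        have "F = F' \<union> nsets (insert v W) 2"
        proof -
          have "nsets (insert v W) 2 = nsets W 2 \<union> star_on v W"
            using vW by (auto simp: nsets_def star_on_def card_2_iff image_iff doubleton_eq_iff)
          then show ?thesis using FH H(1) PW by auto
        qed
        moreover have c4: "card (insert v W) = 4" using W vW by simp
        then have "component (nsets (insert v W) 2)" using W by (auto simp: component_def)
        moreover have "\<Union>F' \<inter> \<Union>(nsets (insert v W) 2) = {}"
          using H(1,3) UW vH Union_nsets_2[of "insert v W"] c4 by auto
        ultimately show ?thesis using nice.add[OF H(2)] by blast
      qed
      \<comment> \<open>Star centres and the vertices of \<open>C_4\<close> and \<open>K_4\<close>
        already have degree \<open>D + 1\<close> in \<open>H\<close>, too much for a neighbour of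
        \<open>v\<close>. Triangles are settled above, so only leaves of stars remain.\<close>
      have star: "nice F \<or> (\<exists>c L. C = star_on c L \<and> c \<notin> L \<and> finite L \<and> card L = D + 1 \<and> l \<in> L)"
        if l: "l \<in> P" "l \<in> \<Union>C" and H: "H = F' \<union> C" "nice F'" "component C" "\<Union>F' \<inter> \<Union>C = {}" for l C F'
      proof -
        have nbC: "nb H l = nb C l" using nb_disjoint[OF H(4) l(2)] H(1) by simp
        then have small: "card (nb C l) \<le> D" using nbH_P[OF l(1)] by simp
        show ?thesis
          using H(3)
        proof (cases rule: component_cases)
          case (Star c L)
          then have "l \<noteq> c" using small nb_star_on[OF Star(1), of c] by auto
          moreover have "L \<noteq> {}" using Star by auto
          then have "\<Union>C = insert c L" using Star(4) Union_star_on by metis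
          ultimately have "l \<in> L" using l(2) by blast
          then show ?thesis using Star by blast
        next
          case (Cycle p q r s)
          then have "card (nb C l) = 2"
            using l(2) nb_four_cycle[OF Cycle(2)] by (auto simp: Union_four_cycle)
          then show ?thesis using small Cycle by simp
        next
          case (Triangle W)
          then have "l \<in> W" using l(2) by (auto simp: nsets_def)
          then show ?thesis using triangle[of l W F'] l H Triangle by auto
        next
          case (K4 W)
          then have "l \<in> W" using l(2) by (auto simp: nsets_def)
          then show ?thesis using small K4 by (simp add: nb_nsets)
        qed
      qed
      show ?thesis
      proof (cases "P \<inter> \<Union>H = {}")
        case True
        then have "\<Union>H \<inter> \<Union>(star_on v P) = {}" using vH starP(2) by auto
        then show ?thesis using nice.add[OF Hn starP(1)] FH by simp
      next
        case False
        then obtain l where l: "l \<in> P" "l \<in> \<Union>H" by blast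
        obtain F' C where H: "H = F' \<union> C" "nice F'" "component C" "\<Union>F' \<inter> \<Union>C = {}" "l \<in> \<Union>C"
          using nice_component_of[OF Hn l(2)] by blast
        show ?thesis
        proof (rule ccontr)
          assume nn: "\<not> nice F"
          then obtain c L where cL: "C = star_on c L" "c \<notin> L" "finite L" "card L = D + 1" "l \<in> L"
            using star[OF l(1) H(5,1,2,3,4)] by blast
          have UC: "\<Union>C = insert c L" using Union_star_on[of L c] cL by auto
          have nbHC: "nb H u = nb C u" if "u \<in> \<Union>C" for u using nb_disjoint[OF H(4) that] H(1) by simp
          have "nb C c = L" "nb C l = {c}" using nb_star_on[OF cL(2)] cL(1,2,5) by auto
          then have nbc: "nb H c = L" and nbl: "nb H l = {c}"
            using nbHC[of c] nbHC[of l] UC cL(5) by blast+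
          have cP': "c \<notin> P" using nbH_P[of c] nbc cL(4) by auto
          have cv: "c \<noteq> v" "v \<notin> L" using vH H(1) UC by auto
          have D1: "D \<ge> 1" using nbH_P[OF l(1)] nbl by simp
          \<comment> \<open>Two stars \<open>K_{1,2}\<close> with the same two leaves form a
            \<open>C_4\<close> component.\<close>
          have PL: "\<not> (P = L \<and> D = 1)"
          proof
            assume a: "P = L \<and> D = 1"
            then have "card (L - {l}) = 1" using cL by simp
            then obtain l' where l': "L - {l} = {l'}" by (auto simp: card_1_singleton_iff)
            then have L: "L = {l, l'}" "l \<noteq> l'" using cL(5) by auto
            have "F = F' \<union> four_cycle v l c l'"
              using FH H(1) cL(1) a L by (auto simp: star_on_def four_cycle_def)
            moreover have "distinct [v, l, c, l']" using L cv cL(2) by auto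
            moreover have "\<Union>F' \<inter> \<Union>(four_cycle v l c l') = {}"
              using H(1,4) UC L vH by (auto simp: Union_four_cycle)
            ultimately show False using nice.add[OF H(2)] nn a by (metis component_def)
          qed
          \<comment> \<open>If \<open>H\<close> is a single star, then \<open>n\<close> is 2 and
            deleting the common leaf \<open>l\<close> leaves two \<open>D\<close>-colourable stars,
            so one deletion would suffice. Otherwise a further component of \<open>H\<close> is
            used.\<close>
          show False
          proof (cases "F' = {}")
            case True
            then have "card H = D + 1" using H(1) cL card_star_on[OF cL(2)] by simp
            then have "n * (D + 1) = 2 * (D + 1)" using card_del[OF fs, of v] cP card by (simp add: H_def P_def)
            then have n2: "n = 2" by (metis Suc_eq_plus1 Suc_not_Zero mult_cancel2 add_eq_0_iff_both_eq_0 zero_neq_one)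
            have "del F {l} = star_on v (P - {l}) \<union> star_on c (L - {l})"
              using FH H(1) True cL l(1) vP cv by (auto simp: del_def star_on_def)
            moreover have "colourable (star_on v (P - {l}) \<union> star_on c (L - {l})) D"
            proof (rule two_stars_colourable)
              show "card (P - {l}) \<le> D" "card (L - {l}) \<le> D" using l cL cP finP by auto
              show "2 \<le> D \<or> (P - {l}) \<inter> (L - {l}) = {}"
              proof (rule ccontr)
                assume "\<not> ?thesis"
                then have D: "D = 1" and "(P - {l}) \<inter> (L - {l}) \<noteq> {}" using D1 by auto
                then obtain x where x: "x \<in> P - {l}" "x \<in> L - {l}" by blast
                have "card (P - {l}) = 1" "card (L - {l}) = 1" using l cL cP finP D by auto
                then have "P - {l} = {x}" "L - {l} = {x}" using x by (metis card_1_singletonE singletonD)+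
                then have "P = L" using l(1) cL(5) by blast
                then show False using PL D by simp
              qed
            qed (use vP cv cP' cL finP in auto)
            ultimately have "good (del F {l})"
              using colourable_imp_good[OF finite_simple_graph_del[OF fs]] by metis
            then have "kill F 1" unfolding kill_def by (intro exI[of _ "{l}"]) auto
            then show False using nk n2 by simp
          next
            case False
            then obtain e where "e \<in> F'" by blast
            moreover from this have "e \<noteq> {}" using nice_simple[OF H(2)] by (auto simp: finite_simple_graph_def)
            ultimately obtain u where u: "u \<in> \<Union>F'" by blast
            obtain F'' C' where F': "F' = F'' \<union> C'" "nice F''" "component C'" "\<Union>F'' \<inter> \<Union>C' = {}"
              using nice_component_of[OF H(2) u] by blast
            \<comment> \<open>A further component that avoids \<open>P\<close> is a component of
              \<open>F\<close> and splits off. One that meets \<open>P\<close> is a star, and its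
              centre \<open>c'\<close> has degree \<open>D + 1\<close> in \<open>F\<close>.\<close>
            show False
            proof (cases "\<Union>C' \<inter> P = {}")
              case True
              have "F = (F'' \<union> C \<union> star_on v P) \<union> C'" using FH H(1) F'(1) by auto
              moreover have "\<Union>(F'' \<union> C \<union> star_on v P) \<inter> \<Union>C' = {}"
              proof -
                have "v \<notin> \<Union>C'" using vH H(1) F'(1) by auto
                then show ?thesis using True F'(1,4) H(4) starP(2) unfolding Union_Un_distrib by auto
              qed
              ultimately show False using split F'(3) nn by blast
            next
              case False
              then obtain l' where l': "l' \<in> P" "l' \<in> \<Union>C'" by blast
              have H': "H = (F'' \<union> C) \<union> C'" using H(1) F'(1) by auto
              have "nice (F'' \<union> C)" using nice.add[OF F'(2) H(3)] H(4) F'(1) by auto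
              moreover have dis': "\<Union>(F'' \<union> C) \<inter> \<Union>C' = {}" using F'(1,4) H(4) by auto
              ultimately obtain c' L' where c': "C' = star_on c' L'" "c' \<notin> L'" "card L' = D + 1" "l' \<in> L'"
                using star[OF l' H' _ F'(3)] nn by blast
              have UC': "\<Union>C' = insert c' L'" using Union_star_on[of L' c'] c' by auto
              have "nb C' c' = L'" using nb_star_on[OF c'(2)] c'(1) by simp
              moreover have "nb H c' = nb C' c'" unfolding H' using UC' by (intro nb_disjoint[OF dis']) blast
              ultimately have "nb H c' = L'" by simp
              then have c'P: "c' \<notin> P" and c'd: "card (nb F c') \<ge> D + 1"
                using nbH_P[of c'] c'(3) card_mono[OF finite_nb[OF fs] nb_mono[OF del_subset[of F "{v}"]], of c']
                by (auto simp: H_def)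
              have c'v: "c' \<noteq> v" using vH H' UC' by auto
              have c'C: "c' \<notin> insert c L" using dis' UC UC' by auto
              have lc: "l \<noteq> v" "l \<noteq> c" using l(1) vP cL by auto
              \<comment> \<open>Deleting \<open>c'\<close> instead of \<open>v\<close> keeps
                \<open>l\<close> adjacent to both centres \<open>c\<close> and \<open>v\<close>,
                with their leaf sets \<open>L\<close> and \<open>P\<close> intact. A nice graph
                allows this only in a \<open>C_4\<close>, where \<open>P = L\<close> and
                \<open>D = 1\<close>.\<close>
              define H3 where "H3 = del F {c'}"
              have n3: "nice H3" using delnice[OF c'd] by (simp add: H3_def)
              have nb3: "nb H3 l = {c, v}" "nb H3 v = P" "nb H3 c = L"
                using nbF[of l] nbF[of c] nbl nbc l(1) cP' cv c'v c'C c'P lc cL(5)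
                by (auto simp: H3_def nb_del P_def)
              have "l \<in> \<Union>H3" using nb3(1) vertex_iff_nb[OF nice_simple[OF n3]] by blast
              with n3 show False
              proof (cases rule: nice_local)
                case Centre
                then have "nb H3 v = {l}" using nb3 by simp
                then show False using nb3 cP D1 by simp
              next
                case (Leaf x)
                then show False using nb3(1) cv by auto
              next
                case (Cycle q r s)
                then have "P = L" using nb3 cv by (auto simp: doubleton_eq_iff)
                then show False using PL Cycle by simp
              next
                case (Triangle x y)
                then have "v = x \<or> v = y" using nb3(1) by auto
                then have "card (nb H3 v) \<le> 2" using Triangle by (auto simp: card_insert_if)
                then show False using nb3 cP Triangle by simp
              next
                case K4
                then show False using nb3(1) cv by simp
              qed
            qed
          qed
        qed
      qed
    qed
  qed
qed

end

section \<open>Star packings and arrowing\<close>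

definition star_packing :: "'v graph \<Rightarrow> nat \<Rightarrow> ('i \<Rightarrow> 'v) \<Rightarrow> ('i \<Rightarrow> 'v set) \<Rightarrow> 'i set \<Rightarrow> bool" where
  "star_packing F k c L J \<longleftrightarrow>
     (\<forall>j\<in>J. finite (L j) \<and> card (L j) \<ge> k \<and> c j \<notin> L j \<and> star_on (c j) (L j) \<subseteq> F) \<and>
     disjoint_family_on (\<lambda>j. insert (c j) (L j)) J"

lemma copies_star_graph:
  "copies a (star_graph k) = {{(j, 0), (j, i)} | j i. j < a \<and> i \<in> {1..k}}"
  by (auto simp: copies_def star_graph_def image_iff) blast+

lemma edge_in_copies_star_graph:
  "j < a \<Longrightarrow> i \<in> {1..k} \<Longrightarrow> {(j, 0), (j, i)} \<in> copies a (star_graph k)"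
  unfolding copies_star_graph by blast

lemma star_packingD:
  assumes "star_packing F k c L J" "j \<in> J"
  shows "finite (L j)" "card (L j) \<ge> k" "c j \<notin> L j" "star_on (c j) (L j) \<subseteq> F"
    "u \<in> L j \<Longrightarrow> {c j, u} \<in> F"
  using assms by (auto simp: star_packing_def star_on_def)

lemma star_packing_eq:
  assumes "star_packing F k c L J" "i \<in> J" "j \<in> J" "insert (c i) (L i) \<inter> insert (c j) (L j) \<noteq> {}"
  shows "i = j"
  using assms unfolding star_packing_def disjoint_family_on_def by blast

lemma star_packingI:
  assumes "\<And>j. j \<in> J \<Longrightarrow> finite (L j) \<and> card (L j) \<ge> k \<and> c j \<notin> L j \<and> star_on (c j) (L j) \<subseteq> F"
    and "\<And>i j. i \<in> J \<Longrightarrow> j \<in> J \<Longrightarrow> insert (c i) (L i) \<inter> insert (c j) (L j) \<noteq> {} \<Longrightarrow> i = j"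
  shows "star_packing F k c L J"
  using assms unfolding star_packing_def disjoint_family_on_def by blast

lemma star_packing_restrict:
  assumes P: "star_packing F k c L J" and J': "J' \<subseteq> J"
    and L': "\<And>j. j \<in> J' \<Longrightarrow> L' j \<subseteq> L j \<and> card (L' j) \<ge> k' \<and> star_on (c j) (L' j) \<subseteq> F'"
  shows "star_packing F' k' c L' J'"
proof (rule star_packingI)
  fix j assume j: "j \<in> J'"
  then show "finite (L' j) \<and> card (L' j) \<ge> k' \<and> c j \<notin> L' j \<and> star_on (c j) (L' j) \<subseteq> F'"
    using L'[OF j] star_packingD[OF P, of j] J' finite_subset by blast
next
  fix i j assume ij: "i \<in> J'" "j \<in> J'" "insert (c i) (L' i) \<inter> insert (c j) (L' j) \<noteq> {}"
  then have "insert (c i) (L i) \<inter> insert (c j) (L j) \<noteq> {}" using L' by blast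
  then show "i = j" using star_packing_eq[OF P] ij J' by blast
qed

lemma Union_copies_star_graph:
  "k \<ge> 1 \<Longrightarrow> \<Union>(copies a (star_graph k)) = {..<a} \<times> {..k}"
proof
  assume "k \<ge> 1"
  show "{..<a} \<times> {..k} \<subseteq> \<Union>(copies a (star_graph k))"
  proof
    fix x assume "x \<in> {..<a} \<times> {..k}"
    then obtain j i where x: "x = (j, i)" "j < a" "i \<le> k" by auto
    show "x \<in> \<Union>(copies a (star_graph k))"
    proof (cases "i = 0")
      case True
      then show ?thesis using x \<open>k \<ge> 1\<close>
        by (intro UnionI[OF edge_in_copies_star_graph[of j a 1 k]]) auto
    next
      case False
      then show ?thesis using x
        by (intro UnionI[OF edge_in_copies_star_graph[of j a i k]]) auto
    qed
  qed
qed (auto simp: copies_star_graph)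

lemma contains_copyI:
  assumes "inj_on \<phi> (\<Union>H)" "(\<lambda>e. \<phi> ` e) ` H \<subseteq> F"
  shows "contains_copy F H"
  unfolding contains_copy_def graph_iso_def
proof (intro exI conjI)
  show "(\<lambda>e. \<phi> ` e) ` H \<subseteq> F" by fact
  show "bij_betw \<phi> (\<Union>H) (\<Union>((\<lambda>e. \<phi> ` e) ` H))"
    using assms(1) by (auto simp: bij_betw_def image_Union)
qed simp

lemma contains_copy_mono: "contains_copy F H \<Longrightarrow> F \<subseteq> F' \<Longrightarrow> contains_copy F' H"
  unfolding contains_copy_def by blast

text \<open>An embedding is read off as images of centres and leaves; conversely \<open>k\<close>
  leaves are chosen injectively in each star. With \<open>k\<close> positive every centre lies on an
  edge and belongs to the vertex set of the copies.\<close>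

lemma contains_copies_star_iff:
  assumes "k \<ge> 1"
  shows "contains_copy F (copies a (star_graph k)) \<longleftrightarrow> (\<exists>c L. star_packing F k c L {..<a})"
proof
  assume "contains_copy F (copies a (star_graph k))"
  then obtain F' \<phi> where F': "F' \<subseteq> F" "bij_betw \<phi> (\<Union>(copies a (star_graph k))) (\<Union>F')"
    "(\<lambda>e. \<phi> ` e) ` copies a (star_graph k) = F'"
    by (auto simp: contains_copy_def graph_iso_def)
  have inj: "inj_on \<phi> ({..<a} \<times> {..k})"
    using F'(2) Union_copies_star_graph[OF assms] by (simp add: bij_betw_def)
  define c where "c j = \<phi> (j, 0)" for j
  define L where "L j = (\<lambda>i. \<phi> (j, i)) ` {1..k}" for j
  have "star_packing F k c L {..<a}"
  proof (rule star_packingI, intro conjI)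
    fix j assume j: "j \<in> {..<a}"
    show "finite (L j)" by (simp add: L_def)
    have "inj_on (\<lambda>i. \<phi> (j, i)) {1..k}" using inj j by (auto simp: inj_on_def)
    then show "card (L j) \<ge> k" by (simp add: L_def card_image)
    show "c j \<notin> L j"
    proof
      assume "c j \<in> L j"
      then obtain i where i: "i \<in> {1..k}" "\<phi> (j, 0) = \<phi> (j, i)" by (auto simp: c_def L_def)
      then have "(j, 0) = (j, i)" using j by (intro inj_onD[OF inj]) auto
      then show False using i by simp
    qed
    show "star_on (c j) (L j) \<subseteq> F"
    proof
      fix e assume "e \<in> star_on (c j) (L j)"
      then obtain i where i: "i \<in> {1..k}" "e = {\<phi> (j, 0), \<phi> (j, i)}" by (auto simp: star_on_def c_def L_def)
      have "{(j, 0), (j, i)} \<in> copies a (star_graph k)" using i j edge_in_copies_star_graph by blast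
      then have "\<phi> ` {(j, 0), (j, i)} \<in> F'" using F'(3) by blast
      then show "e \<in> F" using i F'(1) by auto
    qed
  next
    have sub: "insert (c j) (L j) = \<phi> ` ({j} \<times> {..k})" for j
    proof -
      have "{..k} = insert 0 {1..k}" by auto
      then show ?thesis by (auto simp: c_def L_def)
    qed
    fix i j assume ij: "i \<in> {..<a}" "j \<in> {..<a}" "insert (c i) (L i) \<inter> insert (c j) (L j) \<noteq> {}"
    show "i = j"
    proof (rule ccontr)
      assume "i \<noteq> j"
      then show False
        using inj_on_image_Int[OF inj, of "{i} \<times> {..k}" "{j} \<times> {..k}"] ij unfolding sub by auto
    qed
  qed
  then show "\<exists>c L. star_packing F k c L {..<a}" by blast
next
  assume "\<exists>c L. star_packing F k c L {..<a}"
  then obtain c L where P: "star_packing F k c L {..<a}" by blast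
  have "\<exists>h. inj_on h {1..k} \<and> h ` {1..k} \<subseteq> L j" if "j < a" for j
    using P that card_le_inj[of "{1..k}" "L j"] by (auto simp: star_packing_def)
  then obtain h where h: "\<And>j. j < a \<Longrightarrow> inj_on (h j) {1..k}" "\<And>j. j < a \<Longrightarrow> h j ` {1..k} \<subseteq> L j" by metis
  define \<phi> where "\<phi> = (\<lambda>(j, i). if i = 0 then c j else h j i)"
  have mem: "\<phi> (j, i) \<in> insert (c j) (L j)" if "j < a" "i \<le> k" for j i
  proof (cases "i = 0")
    case False
    then have "h j i \<in> L j" using h(2)[OF that(1)] that(2) by (auto simp: image_subset_iff)
    then show ?thesis by (simp add: \<phi>_def)
  qed (simp add: \<phi>_def)
  show "contains_copy F (copies a (star_graph k))"
  proof (rule contains_copyI)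
    show "inj_on \<phi> (\<Union>(copies a (star_graph k)))"
      unfolding Union_copies_star_graph[OF assms]
    proof (rule inj_onI)
      fix x y assume "x \<in> {..<a} \<times> {..k}" "y \<in> {..<a} \<times> {..k}" and eq: "\<phi> x = \<phi> y"
      then obtain j i j' i' where x: "x = (j, i)" "j < a" "i \<le> k" and y: "y = (j', i')" "j' < a" "i' \<le> k" by auto
      have "insert (c j) (L j) \<inter> insert (c j') (L j') \<noteq> {}" using mem[OF x(2,3)] mem[OF y(2,3)] eq x y by auto
      then have jj: "j = j'" using star_packing_eq[OF P] x y by blast
      have "c j \<notin> L j" using star_packingD(3)[OF P] x by blast
      then have hc: "h j i \<noteq> c j" if "i \<in> {1..k}" for i
        using subsetD[OF h(2)[OF x(2)] imageI[OF that]] by metis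
      have "i = i'"
      proof (cases "i = 0 \<or> i' = 0")
        case True
        show ?thesis
        proof (rule ccontr)
          assume ne: "i \<noteq> i'"
          then consider "i = 0" "i' \<in> {1..k}" | "i' = 0" "i \<in> {1..k}" using True x(3) y(3) by force
          then show False
          proof cases
            case 1
            then show False using eq x(1) y(1) jj hc[OF 1(2)] by (simp add: \<phi>_def)
          next
            case 2
            then show False using eq x(1) y(1) jj hc[OF 2(2)] by (simp add: \<phi>_def)
          qed
        qed
      next
        case False
        then have "h j i = h j i'" using eq x(1) y(1) jj by (simp add: \<phi>_def)
        then show ?thesis using False x(3) y(3) by (intro inj_onD[OF h(1)[OF x(2)]]) auto
      qed
      then show "x = y" using x y jj by simp
    qed
    show "(\<lambda>e. \<phi> ` e) ` copies a (star_graph k) \<subseteq> F"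
    proof
      fix e assume "e \<in> (\<lambda>e. \<phi> ` e) ` copies a (star_graph k)"
      then obtain j i where "j < a" "i \<in> {1..k}" "e = {c j, h j i}" by (auto simp: copies_star_graph \<phi>_def)
      moreover from this have "h j i \<in> L j" using h(2) by blast
      ultimately show "e \<in> F" using star_packingD(5)[OF P, of j] by simp
    qed
  qed
qed

lemma star_packing_reindex:
  assumes P: "star_packing F k c L J" and g: "inj_on g I" "g ` I \<subseteq> J"
  shows "star_packing F k (c \<circ> g) (L \<circ> g) I"
proof (rule star_packingI)
  fix j assume "j \<in> I"
  then have "g j \<in> J" using g by blast
  then show "finite ((L \<circ> g) j) \<and> card ((L \<circ> g) j) \<ge> k \<and> (c \<circ> g) j \<notin> (L \<circ> g) j \<and>
      star_on ((c \<circ> g) j) ((L \<circ> g) j) \<subseteq> F"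
    using star_packingD[OF P] by simp
next
  fix i j assume "i \<in> I" "j \<in> I" "insert ((c \<circ> g) i) ((L \<circ> g) i) \<inter> insert ((c \<circ> g) j) ((L \<circ> g) j) \<noteq> {}"
  then show "i = j" using star_packing_eq[OF P, of "g i" "g j"] g by (auto simp: inj_on_def)
qed

lemma star_packing_imp_copies:
  assumes "k \<ge> 1" "star_packing F k c L J" "finite J" "card J \<ge> a"
  shows "contains_copy F (copies a (star_graph k))"
proof -
  obtain g where g: "inj_on g {..<a}" "g ` {..<a} \<subseteq> J" using card_le_inj[of "{..<a}" J] assms by auto
  have "star_packing F k (c \<circ> g) (L \<circ> g) {..<a}" by (rule star_packing_reindex[OF assms(2) g])
  then show ?thesis using contains_copies_star_iff[OF assms(1)] by blast
qed

lemma pigeonhole_capacities: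
  assumes "finite S" "finite X" "g ` X \<subseteq> S" "card X > (\<Sum>s\<in>S. c s - 1)"
  shows "\<exists>s\<in>S. card {x \<in> X. g x = s} \<ge> c s"
proof (rule ccontr)
  assume n: "\<not> ?thesis"
  have "card X = (\<Sum>s\<in>S. card {x \<in> X. g x = s})"
    using sum.group[OF assms(2,1,3), of "\<lambda>_. 1 :: nat"] by simp
  also have "\<dots> \<le> (\<Sum>s\<in>S. c s - 1)" using n by (intro sum_mono) fastforce
  finally show False using assms(4) by simp
qed

section \<open>Arrowing by disjoint stars, and colourings that avoid the star forests\<close>

context star_ramsey
begin

text \<open>Two pigeonhole arguments: among the \<open>D + 1\<close> edges of each star some colour
  \<open>s\<close> occurs \<open>b s\<close> times, and among the stars some colour is chosen
  \<open>a s\<close> times.\<close>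

lemma stars_arrow:
  assumes P: "star_packing F (D + 1) c L J" and J: "finite J" "card J > (\<Sum>s=1..t. a s - 1)"
  shows "arrows t F (\<lambda>s. copies (a s) (star_graph (b s)))"
  unfolding arrows_def
proof (intro allI impI)
  fix f assume f: "f ` F \<subseteq> {1..t}"
  have "\<exists>s\<in>{1..t}. card {u \<in> L j. f {c j, u} = s} \<ge> b s" if j: "j \<in> J" for j
  proof (rule pigeonhole_capacities)
    show "finite (L j)" using P j by (auto simp: star_packing_def)
    show "(\<lambda>u. f {c j, u}) ` L j \<subseteq> {1..t}" using star_packingD(5)[OF P j] f by blast
    have "card (L j) \<ge> D + 1" using P j by (auto simp: star_packing_def)
    then show "(\<Sum>s=1..t. b s - 1) < card (L j)" by (simp add: D_def)
  qed simp
  then obtain g where g: "\<And>j. j \<in> J \<Longrightarrow> g j \<in> {1..t}"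
    "\<And>j. j \<in> J \<Longrightarrow> card {u \<in> L j. f {c j, u} = g j} \<ge> b (g j)" by metis
  obtain s where s: "s \<in> {1..t}" "card {j \<in> J. g j = s} \<ge> a s"
    using pigeonhole_capacities[of "{1..t}" J g a] g(1) J by (metis finite_atLeastAtMost image_subsetI)
  have "star_packing {e \<in> F. f e = s} (b s) c (\<lambda>j. {u \<in> L j. f {c j, u} = s}) {j \<in> J. g j = s}"
  proof (rule star_packing_restrict[OF P])
    fix j assume j: "j \<in> {j \<in> J. g j = s}"
    then have "star_on (c j) {u \<in> L j. f {c j, u} = s} \<subseteq> {e \<in> F. f e = s}"
      using star_packingD(5)[OF P, of j] by (auto simp: star_on_def)
    then show "{u \<in> L j. f {c j, u} = s} \<subseteq> L j \<and> b s \<le> card {u \<in> L j. f {c j, u} = s} \<and>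
        star_on (c j) {u \<in> L j. f {c j, u} = s} \<subseteq> {e \<in> F. f e = s}"
      using j g(2)[of j] by blast
  qed blast
  moreover have "finite {j \<in> J. g j = s}" using J(1) by simp
  ultimately have "contains_copy {e \<in> F. f e = s} (copies (a s) (star_graph (b s)))"
    using star_packing_imp_copies[OF b_pos[OF s(1)]] s(2) by blast
  then show "\<exists>s\<in>{1..t}. contains_copy {e \<in> F. f e = s} (copies (a s) (star_graph (b s)))" using s by blast
qed

lemma size_ramsey_le:
  assumes n: "n > (\<Sum>s=1..t. a s - 1)"
  shows "size_ramsey t (\<lambda>s. copies (a s) (star_graph (b s))) \<le> n * (D + 1)"
proof -
  \<comment> \<open>The pairing function places the disjoint stars on natural numbers, the vertex
    type over which \<open>size_ramsey\<close> minimises.\<close>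
  define c where "c j = prod_encode (j, 0)" for j
  define L where "L j = (\<lambda>i. prod_encode (j, i)) ` {1..D + 1}" for j
  define F where "F = (\<Union>j<n. star_on (c j) (L j))"
  have cL: "c j \<notin> L j" "finite (L j)" "card (L j) = D + 1" for j
    by (auto simp: c_def L_def prod_encode_eq card_image inj_on_def)
  have "star_packing F (D + 1) c L {..<n}"
  proof (rule star_packingI)
    show "i = j" if "insert (c i) (L i) \<inter> insert (c j) (L j) \<noteq> {}" for i j
      using that by (auto simp: c_def L_def prod_encode_eq)
  qed (use cL in \<open>auto simp: F_def\<close>)
  then have "arrows t F (\<lambda>s. copies (a s) (star_graph (b s)))" by (rule stars_arrow) (use n in auto)
  moreover have "finite_simple_graph F"
    using finite_simple_star_on[OF cL(2,1)] by (auto simp: F_def finite_simple_graph_def)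
  ultimately have "size_ramsey t (\<lambda>s. copies (a s) (star_graph (b s))) \<le> card F"
    unfolding size_ramsey_def by (intro Least_le) blast
  also have "\<dots> \<le> (\<Sum>j<n. card (star_on (c j) (L j)))" unfolding F_def by (rule card_UN_le) simp
  also have "\<dots> = n * (D + 1)" using card_star_on[OF cL(1)] cL(3) by simp
  finally show ?thesis .
qed

text \<open>Every star with \<open>b s\<close> edges of colour \<open>s\<close> must contain a
  deleted vertex assigned to \<open>s\<close>, and disjoint stars contain different ones. Only
  \<open>a s - 1\<close> vertices are assigned to \<open>s\<close>.\<close>

lemma kill_imp_not_arrows:
  assumes fs: "finite_simple_graph F" and kill: "kill F (\<Sum>s=1..t. a s - 1)"
    and a: "\<And>s. s \<in> {1..t} \<Longrightarrow> a s \<ge> 1"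
  shows "\<not> arrows t F (\<lambda>s. copies (a s) (star_graph (b s)))"
proof
  assume ar: "arrows t F (\<lambda>s. copies (a s) (star_graph (b s)))"
  obtain X where X: "finite X" "card X \<le> (\<Sum>s=1..t. a s - 1)" "good (del F X)" using kill by (auto simp: kill_def)
  obtain g where g: "g ` X \<subseteq> {1..t}" "\<And>s. s \<in> {1..t} \<Longrightarrow> card {x \<in> X. g x = s} \<le> a s - 1"
    using distribute_with_capacities[OF _ X(1,2)] by auto
  obtain f0 where f0: "f0 ` del F X \<subseteq> {1..t}"
    "\<And>v s. s \<in> {1..t} \<Longrightarrow> card {e \<in> del F X. v \<in> e \<and> f0 e = s} < b s"
    using X(3) by (auto simp: good_def)
  \<comment> \<open>An edge with both ends deleted takes the colour of an arbitrary one of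
    them.\<close>
  define f where "f e = (if e \<inter> X \<noteq> {} then g (SOME x. x \<in> e \<inter> X) else f0 e)" for e
  have fX: "\<exists>x\<in>e \<inter> X. f e = g x" if "e \<inter> X \<noteq> {}" for e
    using that some_in_eq[of "e \<inter> X"] by (auto simp: f_def)
  have "f e \<in> {1..t}" if e: "e \<in> F" for e
  proof (cases "e \<inter> X = {}")
    case True
    then have "e \<in> del F X" using e by (simp add: del_def)
    then show ?thesis using f0(1) True by (auto simp: f_def)
  next
    case False
    then obtain x where "x \<in> X" "f e = g x" using fX by blast
    then show ?thesis using g(1) by auto
  qed
  then have "f ` F \<subseteq> {1..t}" by blast
  then obtain s where s: "s \<in> {1..t}" and cc: "contains_copy {e \<in> F. f e = s} (copies (a s) (star_graph (b s)))"
    using ar unfolding arrows_def by blast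
  obtain c L where P: "star_packing {e \<in> F. f e = s} (b s) c L {..<a s}"
    using cc contains_copies_star_iff[OF b_pos[OF s]] by blast
  \<comment> \<open>Otherwise all edges of star \<open>j\<close> survive the deletion, and its
    centre has \<open>b s\<close> edges of colour \<open>s\<close> in the good colouring
    \<open>f0\<close>.\<close>
  have "\<exists>x\<in>X. g x = s \<and> x \<in> insert (c j) (L j)" if j: "j < a s" for j
  proof (rule ccontr)
    assume no: "\<not> ?thesis"
    have Pj: "c j \<notin> L j" "card (L j) \<ge> b s" "star_on (c j) (L j) \<subseteq> {e \<in> F. f e = s}"
      using star_packingD[OF P, of j] j by auto
    have "e \<in> del F X \<and> c j \<in> e \<and> f0 e = s" if e: "e \<in> star_on (c j) (L j)" for e
    proof -
      have "e \<inter> X = {}"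
      proof (rule ccontr)
        assume "e \<inter> X \<noteq> {}"
        then obtain x where "x \<in> e" "x \<in> X" "f e = g x" using fX by blast
        moreover have "e \<subseteq> insert (c j) (L j)" "f e = s" using e Pj(3) by (auto simp: star_on_def)
        ultimately have "g x = s \<and> x \<in> insert (c j) (L j)" "x \<in> X" by auto
        then show False using no by blast
      qed
      moreover have "e \<in> F" "f e = s" "c j \<in> e" using e Pj(3) by (auto simp: star_on_def)
      ultimately show ?thesis by (simp add: del_def f_def)
    qed
    then have "star_on (c j) (L j) \<subseteq> {e \<in> del F X. c j \<in> e \<and> f0 e = s}" by blast
    moreover have "finite {e \<in> del F X. c j \<in> e \<and> f0 e = s}"
      using finite_simple_graph_del[OF fs] by (auto simp: finite_simple_graph_def)
    ultimately have "card (L j) \<le> card {e \<in> del F X. c j \<in> e \<and> f0 e = s}"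
      using card_star_on[OF Pj(1)] card_mono by metis
    then show False using f0(2)[OF s, of "c j"] Pj(2) by simp
  qed
  then obtain x where x: "\<And>j. j < a s \<Longrightarrow> x j \<in> X \<and> g (x j) = s \<and> x j \<in> insert (c j) (L j)" by metis
  have "inj_on x {..<a s}"
  proof (rule inj_onI)
    fix i j assume ij: "i \<in> {..<a s}" "j \<in> {..<a s}" "x i = x j"
    then have "insert (c i) (L i) \<inter> insert (c j) (L j) \<noteq> {}" using x[of i] x[of j] by auto
    then show "i = j" using star_packing_eq[OF P] ij by blast
  qed
  then have "a s \<le> card {x \<in> X. g x = s}"
    using card_inj_on_le[of x "{..<a s}" "{x \<in> X. g x = s}"] x X(1) by auto
  then show False using g(2)[OF s] a[OF s] by simp
qed

text \<open>All of \<open>C\<close> gets colour \<open>r\<close>. It has too few vertices for two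
  disjoint stars with \<open>b r\<close> edges, so it raises the number of stars of colour
  \<open>r\<close> by at most one.\<close>

lemma not_arrows_add_small_component:
  assumes fs: "finite_simple_graph F" and na: "\<not> arrows t F (\<lambda>s. copies ((a(r := a r - 1)) s) (star_graph (b s)))"
    and dis: "\<Union>F \<inter> \<Union>C = {}" and C: "finite (\<Union>C)" "card (\<Union>C) < 2 * (b r + 1)" and r: "r \<in> {1..t}"
  shows "\<not> arrows t (F \<union> C) (\<lambda>s. copies (a s) (star_graph (b s)))"
proof
  assume ar: "arrows t (F \<union> C) (\<lambda>s. copies (a s) (star_graph (b s)))"
  obtain f0 where f0: "f0 ` F \<subseteq> {1..t}"
    "\<And>s. s \<in> {1..t} \<Longrightarrow> \<not> contains_copy {e \<in> F. f0 e = s} (copies ((a(r := a r - 1)) s) (star_graph (b s)))"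
    using na by (auto simp: arrows_def)
  define f where "f e = (if e \<in> F then f0 e else r)" for e
  have "f ` (F \<union> C) \<subseteq> {1..t}" using f0(1) r by (auto simp: f_def)
  then obtain s where s: "s \<in> {1..t}" and cc: "contains_copy {e \<in> F \<union> C. f e = s} (copies (a s) (star_graph (b s)))"
    using ar unfolding arrows_def by blast
  show False
  proof (cases "s = r")
    case False
    then have "{e \<in> F \<union> C. f e = s} \<subseteq> {e \<in> F. f0 e = s}" by (auto simp: f_def split: if_splits)
    then show False using contains_copy_mono[OF cc] f0(2)[OF s] False by simp
  next
    case True
    note cc' = cc[unfolded True]
    obtain c L where P: "star_packing {e \<in> F \<union> C. f e = r} (b r) c L {..<a r}"
      using cc' contains_copies_star_iff[OF b_pos[OF r]] by blast
    \<comment> \<open>A star with an edge outside \<open>F\<close> lies entirely in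
      \<open>C\<close>, since no edge joins the two vertex sets; hence at most one index falls
      outside \<open>J\<close>.\<close>
    define J where "J = {j \<in> {..<a r}. star_on (c j) (L j) \<subseteq> F}"
    have inC: "insert (c j) (L j) \<subseteq> \<Union>C" if j: "j < a r" "j \<notin> J" for j
    proof -
      obtain u where u: "u \<in> L j" "{c j, u} \<notin> F" using j by (auto simp: J_def star_on_def)
      have st: "{c j, w} \<in> F \<union> C" if "w \<in> L j" for w using P j(1) that by (auto simp: star_packing_def star_on_def)
      have cC: "c j \<in> \<Union>C" using st[OF u(1)] u(2) by auto
      have "w \<in> \<Union>C" if "w \<in> L j" for w using st[OF that] cC dis by auto
      then show ?thesis using cC by blast
    qed
    have "card ({..<a r} - J) \<le> 1"
    proof (rule ccontr)
      assume "\<not> ?thesis"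
      then obtain i j where ij: "i \<in> {..<a r} - J" "j \<in> {..<a r} - J" "i \<noteq> j"
        by (metis One_nat_def card_le_Suc0_iff_eq finite_Diff finite_lessThan)
      have c1: "card (insert (c j) (L j)) \<ge> b r + 1" "finite (insert (c j) (L j))" if "j \<in> {..<a r} - J" for j
        using P that by (auto simp: star_packing_def)
      have "insert (c i) (L i) \<inter> insert (c j) (L j) = {}"
        using P ij unfolding star_packing_def disjoint_family_on_def by blast
      then have "card (insert (c i) (L i) \<union> insert (c j) (L j)) = card (insert (c i) (L i)) + card (insert (c j) (L j))"
        by (rule card_Un_disjoint[OF c1(2)[OF ij(1)] c1(2)[OF ij(2)]])
      moreover have "insert (c i) (L i) \<union> insert (c j) (L j) \<subseteq> \<Union>C" using inC ij by blast
      then have "card (insert (c i) (L i) \<union> insert (c j) (L j)) \<le> card (\<Union>C)" by (rule card_mono[OF C(1)])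
      moreover have "2 * (b r + 1) \<le> card (insert (c i) (L i)) + card (insert (c j) (L j))"
        unfolding mult_2 by (rule add_mono[OF c1(1)[OF ij(1)] c1(1)[OF ij(2)]])
      ultimately show False using C(2) by (metis leD le_trans)
    qed
    moreover have "card ({..<a r} - J) = a r - card J"
    proof -
      have "J \<subseteq> {..<a r}" by (auto simp: J_def)
      then show ?thesis by (simp add: card_Diff_subset finite_subset)
    qed
    ultimately have "a r - 1 \<le> card J" by linarith
    moreover have "star_packing {e \<in> F. f0 e = r} (b r) c L J"
    proof (rule star_packing_restrict[OF P])
      fix j assume j: "j \<in> J"
      then have jJ: "j \<in> {..<a r}" "star_on (c j) (L j) \<subseteq> F" by (auto simp: J_def)
      then have "star_on (c j) (L j) \<subseteq> {e \<in> F. f0 e = r}"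
        using star_packingD(4)[OF P jJ(1)] by (auto simp: f_def split: if_splits)
      then show "L j \<subseteq> L j \<and> b r \<le> card (L j) \<and> star_on (c j) (L j) \<subseteq> {e \<in> F. f0 e = r}"
        using star_packingD(2)[OF P jJ(1)] by blast
    qed (auto simp: J_def)
    moreover have "finite J" by (simp add: J_def)
    ultimately have "contains_copy {e \<in> F. f0 e = r} (copies (a r - 1) (star_graph (b r)))"
      using star_packing_imp_copies[OF b_pos[OF r]] by blast
    then show False using f0(2)[OF r] by simp
  qed
qed

end

section \<open>Isomorphisms with the model graphs\<close>

lemma graph_isoI:
  assumes "inj_on \<phi> (\<Union>G)" "(\<lambda>e. \<phi> ` e) ` G = H"
  shows "G \<simeq>\<^sub>g H"
  unfolding graph_iso_def
proof (intro exI conjI)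
  have "\<phi> ` \<Union>G = \<Union>H" unfolding assms(2)[symmetric] by (rule image_Union)
  then show "bij_betw \<phi> (\<Union>G) (\<Union>H)" using assms(1) by (simp add: bij_betw_def)
qed (rule assms(2))

lemma graph_iso_trans:
  assumes "G \<simeq>\<^sub>g H" "H \<simeq>\<^sub>g K" shows "G \<simeq>\<^sub>g K"
proof -
  obtain \<phi> \<psi> where \<phi>: "bij_betw \<phi> (\<Union>G) (\<Union>H)" "(\<lambda>e. \<phi> ` e) ` G = H"
    and \<psi>: "bij_betw \<psi> (\<Union>H) (\<Union>K)" "(\<lambda>e. \<psi> ` e) ` H = K"
    using assms by (auto simp: graph_iso_def)
  show ?thesis unfolding graph_iso_def
  proof (intro exI conjI)
    show "bij_betw (\<psi> \<circ> \<phi>) (\<Union>G) (\<Union>K)" using bij_betw_trans \<phi>(1) \<psi>(1) by blast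
    have "(\<lambda>e. (\<psi> \<circ> \<phi>) ` e) ` G = (\<lambda>e. \<psi> ` e) ` (\<lambda>e. \<phi> ` e) ` G" by (simp only: image_comp comp_def)
    then show "(\<lambda>e. (\<psi> \<circ> \<phi>) ` e) ` G = K" using \<phi>(2) \<psi>(2) by simp
  qed
qed

lemma graph_iso_glue:
  assumes "G \<simeq>\<^sub>g H" "G' \<simeq>\<^sub>g H'" "\<Union>G \<inter> \<Union>G' = {}" "\<Union>H \<inter> \<Union>H' = {}"
  shows "G \<union> G' \<simeq>\<^sub>g H \<union> H'"
proof -
  obtain \<phi> \<psi> where \<phi>: "bij_betw \<phi> (\<Union>G) (\<Union>H)" "(\<lambda>e. \<phi> ` e) ` G = H"
    and \<psi>: "bij_betw \<psi> (\<Union>G') (\<Union>H')" "(\<lambda>e. \<psi> ` e) ` G' = H'"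
    using assms by (auto simp: graph_iso_def)
  define \<chi> where "\<chi> x = (if x \<in> \<Union>G then \<phi> x else \<psi> x)" for x
  have c1: "\<chi> x = \<phi> x" if "x \<in> \<Union>G" for x using that by (simp add: \<chi>_def)
  have c2: "\<chi> x = \<psi> x" if "x \<in> \<Union>G'" for x using that assms(3) by (auto simp: \<chi>_def)
  have "bij_betw \<chi> (\<Union>G) (\<Union>H)" using \<phi>(1) c1 by (metis bij_betw_cong)
  moreover have "bij_betw \<chi> (\<Union>G') (\<Union>H')" using \<psi>(1) c2 by (metis bij_betw_cong)
  ultimately have "bij_betw \<chi> (\<Union>G \<union> \<Union>G') (\<Union>H \<union> \<Union>H')" using assms(4) by (rule bij_betw_combine)
  moreover have "(\<lambda>e. \<chi> ` e) ` G = H"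
  proof -
    have "\<chi> ` e = \<phi> ` e" if "e \<in> G" for e using that by (intro image_cong) (auto intro: c1)
    then show ?thesis using \<phi>(2) by (metis (no_types, lifting) image_cong)
  qed
  moreover have "(\<lambda>e. \<chi> ` e) ` G' = H'"
  proof -
    have "\<chi> ` e = \<psi> ` e" if "e \<in> G'" for e using that by (intro image_cong) (auto intro: c2)
    then show ?thesis using \<psi>(2) by (metis (no_types, lifting) image_cong)
  qed
  ultimately show ?thesis unfolding graph_iso_def by (intro exI[of _ \<chi>]) (simp add: image_Un)
qed

lemma graph_iso_image: "inj \<psi> \<Longrightarrow> H \<simeq>\<^sub>g (\<lambda>e. \<psi> ` e) ` H"
  by (rule graph_isoI[of \<psi>]) (auto simp: inj_on_def)

lemma graph_iso_disj_union:
  assumes "G \<simeq>\<^sub>g H" "G' \<simeq>\<^sub>g H'" "\<Union>G \<inter> \<Union>G' = {}"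
  shows "G \<union> G' \<simeq>\<^sub>g H \<squnion>\<^sub>g H'"
  unfolding disj_union_def
proof (rule graph_iso_glue[OF _ _ assms(3)])
  show "G \<simeq>\<^sub>g (`) Inl ` H" using graph_iso_trans[OF assms(1) graph_iso_image[of Inl]] by simp
  show "G' \<simeq>\<^sub>g (`) Inr ` H'" using graph_iso_trans[OF assms(2) graph_iso_image[of Inr]] by simp
qed auto

lemma graph_iso_copies_Suc:
  assumes "G \<simeq>\<^sub>g copies m H" "C \<simeq>\<^sub>g H" "\<Union>G \<inter> \<Union>C = {}"
  shows "G \<union> C \<simeq>\<^sub>g copies (Suc m) H"
proof -
  have "copies (Suc m) H = copies m H \<union> (\<lambda>e. Pair m ` e) ` H"
    by (auto simp: copies_def lessThan_Suc)
  moreover have "G \<union> C \<simeq>\<^sub>g copies m H \<union> (\<lambda>e. Pair m ` e) ` H"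
  proof (rule graph_iso_glue[OF assms(1) _ assms(3)])
    show "C \<simeq>\<^sub>g (\<lambda>e. Pair m ` e) ` H"
      by (rule graph_iso_trans[OF assms(2) graph_iso_image]) (simp add: inj_on_def)
  qed (auto simp: copies_def)
  ultimately show ?thesis by simp
qed

lemma graph_iso_copies_0: "G \<simeq>\<^sub>g copies 0 H \<longleftrightarrow> G = {}"
  by (auto simp: graph_iso_def copies_def bij_betw_def)

lemma star_on_iso:
  assumes "v \<notin> L" "finite L" "card L = k"
  shows "star_on v L \<simeq>\<^sub>g star_graph k"
proof -
  obtain h where h: "bij_betw h L {1..k}" using ex_bij_betw_finite_nat[of L] assms
    by (metis card_atLeastAtMost diff_Suc_1 finite_atLeastAtMost finite_same_card_bij)
  define \<phi> where "\<phi> x = (if x = v then 0 else h x)" for x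
  have hL: "\<phi> u = h u" if "u \<in> L" for u using that assms(1) by (auto simp: \<phi>_def)
  have "h u \<in> {1..k}" if "u \<in> L" for u using h that by (auto simp: bij_betw_def)
  then have h0: "h u \<noteq> 0" if "u \<in> L" for u using that by fastforce
  show ?thesis
  proof (rule graph_isoI[of \<phi>])
    have "inj_on \<phi> (insert v L)"
      using h h0 assms(1) by (auto simp: inj_on_def bij_betw_def \<phi>_def)
    then show "inj_on \<phi> (\<Union>(star_on v L))" by (rule inj_on_subset) (auto simp: star_on_def)
    have "(\<lambda>e. \<phi> ` e) ` star_on v L = (\<lambda>u. {0, h u}) ` L"
      unfolding star_on_def image_image by (rule image_cong) (auto simp: hL, auto simp: \<phi>_def)
    also have "\<dots> = (\<lambda>i. {0, i}) ` h ` L" by (simp add: image_image)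
    also have "h ` L = {1..k}" using h by (simp add: bij_betw_def)
    finally show "(\<lambda>e. \<phi> ` e) ` star_on v L = star_graph k" by (auto simp: star_graph_def)
  qed
qed

lemma nsets_iso:
  assumes "finite W" "card W = k"
  shows "nsets W 2 \<simeq>\<^sub>g complete_graph k"
proof -
  obtain h where h: "bij_betw h W {..<k}"
    using assms by (metis card_lessThan finite_lessThan finite_same_card_bij)
  show ?thesis
  proof (rule graph_isoI[of h])
    show "inj_on h (\<Union>(nsets W 2))"
      using h by (auto simp: bij_betw_def nsets_def intro: inj_on_subset)
    show "(\<lambda>e. h ` e) ` nsets W 2 = complete_graph k"
      using bij_betw_nsets[OF h, of 2] by (simp add: complete_graph_def bij_betw_def)
  qed
qed

lemma four_cycle_iso:
  assumes "distinct [p, q, r, s]"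
  shows "four_cycle p q r s \<simeq>\<^sub>g cycle_graph 4"
proof -
  define \<phi> :: "'a \<Rightarrow> nat" where "\<phi> x = (if x = p then 0 else if x = q then 1 else if x = r then 2 else 3)" for x
  have "{i. i < (4::nat)} = {0, 1, 2, 3}" by auto
  moreover have "cycle_graph 4 = (\<lambda>i. {i, (i + 1) mod 4}) ` {i. i < 4}" by (auto simp: cycle_graph_def)
  ultimately have "cycle_graph 4 = (\<lambda>i. {i, (i + 1) mod 4}) ` {0, 1, 2, 3}" by simp
  moreover have "(0 + 1) mod 4 = (1 :: nat)" "(1 + 1) mod 4 = (2 :: nat)" "(2 + 1) mod 4 = (3 :: nat)" "(3 + 1) mod 4 = (0 :: nat)"
    by simp_all
  ultimately have c: "cycle_graph 4 = {{0, 1}, {1, 2}, {2, 3}, {3, 0}}"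
    by (simp only: image_insert image_empty)
  have v: "\<phi> p = 0" "\<phi> q = 1" "\<phi> r = 2" "\<phi> s = 3" using assms by (auto simp: \<phi>_def)
  show ?thesis
  proof (rule graph_isoI[of \<phi>])
    show "inj_on \<phi> (\<Union>(four_cycle p q r s))"
      using assms unfolding Union_four_cycle by (auto simp: inj_on_def v)
    show "(\<lambda>e. \<phi> ` e) ` four_cycle p q r s = cycle_graph 4"
      unfolding c four_cycle_def image_insert image_empty v by (rule refl)
  qed
qed

section \<open>Sorting the components by type\<close>

context star_ramsey
begin

text \<open>A common description of a \<open>C_4\<close> for \<open>D\<close> = 1 and a
  \<open>K_4\<close> for \<open>D\<close> = 2: the components of weight 2, both on four
  vertices.\<close>

definition big_component :: "'v graph \<Rightarrow> bool" where
  "big_component F \<longleftrightarrow> (\<exists>F' C. F = F' \<union> C \<and> nice F' \<and> finite_simple_graph C \<and> \<Union>F' \<inter> \<Union>C = {} \<and>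
     card (\<Union>C) = 4 \<and> card C = 2 * (D + 1))"

lemma big_component_add:
  assumes "big_component F" "component C" "\<Union>F \<inter> \<Union>C = {}"
  shows "big_component (F \<union> C)"
proof -
  obtain F' C' where F': "F = F' \<union> C'" "nice F'" "finite_simple_graph C'" "\<Union>F' \<inter> \<Union>C' = {}"
    "card (\<Union>C') = 4" "card C' = 2 * (D + 1)"
    using assms(1) by (auto simp: big_component_def)
  have "nice (F' \<union> C)" using nice.add[OF F'(2) assms(2)] assms(3) F'(1) by auto
  moreover have "\<Union>(F' \<union> C) \<inter> \<Union>C' = {}" using F'(1,4) assms(3) by auto
  moreover have "F \<union> C = (F' \<union> C) \<union> C'" using F'(1) by auto
  ultimately show ?thesis using F' unfolding big_component_def by blast
qed

lemma big_componentI: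
  assumes "nice F" "component C" "\<Union>F \<inter> \<Union>C = {}" "card (\<Union>C) = 4" "card C = 2 * (D + 1)"
  shows "big_component (F \<union> C)"
  using assms component_simple unfolding big_component_def by blast

definition parts :: "nat \<Rightarrow> nat \<Rightarrow> nat \<Rightarrow> nat \<Rightarrow> 'v graph \<Rightarrow> 'v graph \<Rightarrow> 'v graph \<Rightarrow> 'v graph \<Rightarrow> bool" where
  "parts d c c' k F1 F2 F3 F4 \<longleftrightarrow>
     F1 \<simeq>\<^sub>g copies d (cycle_graph 4) \<and> F2 \<simeq>\<^sub>g copies c (complete_graph 3) \<and>
     F3 \<simeq>\<^sub>g copies c' (complete_graph 4) \<and> F4 \<simeq>\<^sub>g copies k (star_graph (D + 1)) \<and>
     \<Union>F1 \<inter> (\<Union>F2 \<union> \<Union>F3 \<union> \<Union>F4) = {} \<and> \<Union>F2 \<inter> (\<Union>F3 \<union> \<Union>F4) = {} \<and> \<Union>F3 \<inter> \<Union>F4 = {} \<and>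
     (d > 0 \<longrightarrow> D = 1) \<and> (c + c' > 0 \<longrightarrow> exc)"

text \<open>Components are collected by type while the union is built. The edge count later
  determines \<open>k\<close> from the other three numbers.\<close>

lemma nice_parts:
  "nice F \<Longrightarrow> \<exists>d c c' k F1 F2 F3 F4. parts d c c' k F1 F2 F3 F4 \<and> F = F1 \<union> F2 \<union> F3 \<union> F4 \<and>
     card F = 4 * d + 3 * c + 6 * c' + (D + 1) * k \<and> (d + c' > 0 \<longrightarrow> big_component F)"
proof (induction rule: nice.induct)
  case empty
  have "parts 0 0 0 0 {} {} {} ({} :: 'a graph)" by (simp add: parts_def graph_iso_copies_0)
  then show ?case by (intro exI[of _ 0] exI[of _ "{}"]) simp
next
  case (add F C)
  then obtain d c c' k F1 F2 F3 F4 where P: "parts d c c' k F1 F2 F3 F4" and F: "F = F1 \<union> F2 \<union> F3 \<union> F4"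
    and cF: "card F = 4 * d + 3 * c + 6 * c' + (D + 1) * k" and big: "d + c' > 0 \<longrightarrow> big_component F" by blast
  have cc: "card (F \<union> C) = card F + card C"
    using card_disjoint_graphs[OF nice_simple component_simple] add.hyps by blast
  have big': "d + c' > 0 \<longrightarrow> big_component (F \<union> C)" using big big_component_add add.hyps(2,3) by blast
  have dis: "\<Union>F1 \<inter> \<Union>C = {}" "\<Union>F2 \<inter> \<Union>C = {}" "\<Union>F3 \<inter> \<Union>C = {}" "\<Union>F4 \<inter> \<Union>C = {}"
    using add.hyps(3) F by auto
  then have dis': "\<Union>C \<inter> \<Union>F1 = {}" "\<Union>C \<inter> \<Union>F2 = {}" "\<Union>C \<inter> \<Union>F3 = {}" "\<Union>C \<inter> \<Union>F4 = {}"
    by blast+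
  note P' = P[unfolded parts_def]
  have eqs: "F \<union> C = (F1 \<union> C) \<union> F2 \<union> F3 \<union> F4" "F \<union> C = F1 \<union> (F2 \<union> C) \<union> F3 \<union> F4"
    "F \<union> C = F1 \<union> F2 \<union> (F3 \<union> C) \<union> F4" "F \<union> C = F1 \<union> F2 \<union> F3 \<union> (F4 \<union> C)" using F by auto
  show ?case
    using add.hyps(2)
  proof (cases rule: component_cases)
    case (Star v L)
    have "F4 \<union> C \<simeq>\<^sub>g copies (Suc k) (star_graph (D + 1))"
      using graph_iso_copies_Suc[OF _ star_on_iso[OF Star(1,2,3), folded Star(4)] dis(4)] P' by blast
    then have pts: "parts d c c' (Suc k) F1 F2 F3 (F4 \<union> C)"
      using P' dis unfolding parts_def Union_Un_distrib Int_Un_distrib by simp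
    have cC: "card C = D + 1" using Star card_star_on[of v L] by simp
    show ?thesis
    proof (intro exI conjI)
      show "parts d c c' (Suc k) F1 F2 F3 (F4 \<union> C)" by (rule pts)
      show "F \<union> C = F1 \<union> F2 \<union> F3 \<union> (F4 \<union> C)" by (rule eqs(4))
      show "card (F \<union> C) = 4 * d + 3 * c + 6 * c' + (D + 1) * Suc k" using cc cF cC by simp
      show "d + c' > 0 \<longrightarrow> big_component (F \<union> C)" using big' by blast
    qed
  next
    case (Cycle p q r s)
    have "F1 \<union> C \<simeq>\<^sub>g copies (Suc d) (cycle_graph 4)"
      using graph_iso_copies_Suc[OF _ four_cycle_iso[OF Cycle(2), folded Cycle(3)] dis(1)] P' by blast
    then have pts: "parts (Suc d) c c' k (F1 \<union> C) F2 F3 F4"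
      using P' dis dis' Cycle(1) unfolding parts_def Union_Un_distrib Int_Un_distrib Int_Un_distrib2 by simp
    have cC: "card C = 4" "card (\<Union>C) = 4" using Cycle card_four_cycle[of p q r s]
      by (auto simp: Union_four_cycle)
    have bC: "big_component (F \<union> C)" using big_componentI[OF add.hyps(1,2,3)] cC Cycle(1) by simp
    show ?thesis
    proof (intro exI conjI)
      show "parts (Suc d) c c' k (F1 \<union> C) F2 F3 F4" by (rule pts)
      show "F \<union> C = (F1 \<union> C) \<union> F2 \<union> F3 \<union> F4" by (rule eqs(1))
      show "card (F \<union> C) = 4 * Suc d + 3 * c + 6 * c' + (D + 1) * k" using cc cF cC by simp
      show "Suc d + c' > 0 \<longrightarrow> big_component (F \<union> C)" using bC by blast
    qed
  next
    case (Triangle W)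
    have "F2 \<union> C \<simeq>\<^sub>g copies (Suc c) (complete_graph 3)"
      using graph_iso_copies_Suc[OF _ nsets_iso[OF Triangle(3,4), folded Triangle(5)] dis(2)] P' by blast
    then have pts: "parts d (Suc c) c' k F1 (F2 \<union> C) F3 F4"
      using P' dis dis' Triangle(1) unfolding parts_def Union_Un_distrib Int_Un_distrib Int_Un_distrib2 by simp
    have cC: "card C = 3" using Triangle by (simp add: card_nsets choose_two)
    show ?thesis
    proof (intro exI conjI)
      show "parts d (Suc c) c' k F1 (F2 \<union> C) F3 F4" by (rule pts)
      show "F \<union> C = F1 \<union> (F2 \<union> C) \<union> F3 \<union> F4" by (rule eqs(2))
      show "card (F \<union> C) = 4 * d + 3 * Suc c + 6 * c' + (D + 1) * k" using cc cF cC by simp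
      show "d + c' > 0 \<longrightarrow> big_component (F \<union> C)" using big' by blast
    qed
  next
    case (K4 W)
    have "F3 \<union> C \<simeq>\<^sub>g copies (Suc c') (complete_graph 4)"
      using graph_iso_copies_Suc[OF _ nsets_iso[OF K4(3,4), folded K4(5)] dis(3)] P' by blast
    then have pts: "parts d c (Suc c') k F1 F2 (F3 \<union> C) F4"
      using P' dis dis' K4(1) unfolding parts_def Union_Un_distrib Int_Un_distrib Int_Un_distrib2 by simp
    have cC: "card C = 6" "card (\<Union>C) = 4"
      using K4 Union_nsets_2[of W] by (auto simp: card_nsets choose_two)
    have bC: "big_component (F \<union> C)" using big_componentI[OF add.hyps(1,2,3)] cC K4(2) by simp
    show ?thesis
    proof (intro exI conjI)
      show "parts d c (Suc c') k F1 F2 (F3 \<union> C) F4" by (rule pts)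
      show "F \<union> C = F1 \<union> F2 \<union> (F3 \<union> C) \<union> F4" by (rule eqs(3))
      show "card (F \<union> C) = 4 * d + 3 * c + 6 * Suc c' + (D + 1) * k" using cc cF cC by simp
      show "d + Suc c' > 0 \<longrightarrow> big_component (F \<union> C)" using bC by blast
    qed
  qed
qed

end

section \<open>Components of weight two force multiplicity one\<close>

context star_ramsey
begin

text \<open>If \<open>a r\<close> were at least 2, the graph without the big component could be
  coloured for the tuple with \<open>a r\<close> lowered by one. Four vertices hold only one star
  with two edges, so giving them colour \<open>r\<close> would complete a colouring of
  \<open>F\<close>.\<close>

lemma big_component_multiplicity:
  assumes big: "big_component F" and card: "card F = n * (D + 1)" and n: "n = (\<Sum>s=1..t. a s - 1) + 1"
    and ar: "arrows t F (\<lambda>s. copies (a s) (star_graph (b s)))"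
    and a: "\<And>s. s \<in> {1..t} \<Longrightarrow> a s \<ge> 1" and r: "r \<in> {1..t}" "b r = 2"
  shows "a r = 1"
proof (rule ccontr)
  assume "a r \<noteq> 1"
  then have ar2: "a r \<ge> 2" using a[OF r(1)] by simp
  obtain F' C where F: "F = F' \<union> C" "nice F'" "finite_simple_graph C" "\<Union>F' \<inter> \<Union>C = {}"
    and C: "card (\<Union>C) = 4" "card C = 2 * (D + 1)"
    using big by (auto simp: big_component_def)
  have fs: "finite_simple_graph F'" using nice_simple[OF F(2)] .
  obtain k where k: "card F' = k * (D + 1)" "kill F' k" using nice_kill[OF F(2)] by blast
  have "card F = card F' + card C" using card_disjoint_graphs[OF fs F(3,4)] F(1) by simp
  then have "n * (D + 1) = (k + 2) * (D + 1)" using card k(1) C(2) by (simp only: distrib_right)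
  \<comment> \<open>The big component has weight 2 but lowers the number of allowed deletions only
    by one, so the remaining \<open>n - 2\<close> deletions are exactly what \<open>F'\<close>
    needs.\<close>
  then have nk: "n = k + 2" by (simp only: mult_cancel2) simp
  define a' where "a' = a(r := a r - 1)"
  have "(\<Sum>s\<in>{1..t} - {r}. a' s - 1) = (\<Sum>s\<in>{1..t} - {r}. a s - 1)" by (rule sum.cong) (auto simp: a'_def)
  then have "(\<Sum>s=1..t. a s - 1) = (\<Sum>s=1..t. a' s - 1) + 1"
    using ar2 sum.remove[OF _ r(1), of "\<lambda>s. a s - 1"] sum.remove[OF _ r(1), of "\<lambda>s. a' s - 1"]
    by (simp add: a'_def)
  then have kill: "kill F' (\<Sum>s=1..t. a' s - 1)" using k(2) n nk by simp
  have a': "a' s \<ge> 1" if "s \<in> {1..t}" for s using a[OF that] ar2 by (auto simp: a'_def)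
  have "\<not> arrows t F' (\<lambda>s. copies (a' s) (star_graph (b s)))"
    by (rule kill_imp_not_arrows[OF fs kill a'])
  moreover have "finite (\<Union>C)" "card (\<Union>C) < 2 * (b r + 1)" using C(1) r(2) card_ge_0_finite[of "\<Union>C"] by simp_all
  ultimately have "\<not> arrows t (F' \<union> C) (\<lambda>s. copies (a s) (star_graph (b s)))"
    using not_arrows_add_small_component[OF fs _ F(4) _ _ r(1), of a] unfolding a'_def by blast
  then show False using ar F(1) by simp
qed

end

lemma parts_iso:
  assumes "F2 \<simeq>\<^sub>g H2" "F3 \<simeq>\<^sub>g H3" "F4 \<simeq>\<^sub>g H4" "\<Union>F2 \<inter> (\<Union>F3 \<union> \<Union>F4) = {}" "\<Union>F3 \<inter> \<Union>F4 = {}"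
  shows "F2 \<union> F3 \<union> F4 \<simeq>\<^sub>g H2 \<squnion>\<^sub>g H3 \<squnion>\<^sub>g H4"
  unfolding Un_assoc using assms by (intro graph_iso_disj_union) auto

section \<open>The classification of size Ramsey minimal graphs\<close>

theorem theorem1p5:
  fixes t :: nat and a b :: "nat \<Rightarrow> nat" and A B :: nat and G :: "'v graph"
  assumes "t \<ge> 1"
    and "\<forall>s\<in>{1..t}. a s \<ge> 1"
    and "\<forall>s\<in>{1..t}. b s \<ge> 1"
    and "\<forall>r\<in>{1..t}. \<forall>s\<in>{1..t}. r \<le> s \<longrightarrow> b r \<ge> b s"
    and "A = (\<Sum>s=1..t. a s)"
    and "B = (\<Sum>s=1..t. b s) - t + 1"
    and "size_ramsey_minimal t G (\<lambda>s. copies (a s) (star_graph (b s)))"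
  shows "G \<simeq>\<^sub>g copies (A - t + 1) (star_graph B)
    \<or> (a 1 = 1 \<and> b 1 = 2 \<and> (\<forall>s\<in>{2..t}. b s = 1) \<and>
        (\<exists>c. 1 \<le> c \<and> c \<le> (A - t + 1) div 2 \<and>
          G \<simeq>\<^sub>g copies c (cycle_graph 4) \<squnion>\<^sub>g copies (A - t + 1 - 2 * c) (star_graph 2)))
    \<or> (t \<ge> 2 \<and> b 1 = 2 \<and> b 2 = 2 \<and> (\<forall>s\<in>{3..t}. b s = 1) \<and>
        ((\<exists>c. 1 \<le> c \<and> c \<le> A - t + 1 \<and>
            G \<simeq>\<^sub>g copies c (complete_graph 3) \<squnion>\<^sub>g copies (A - t + 1 - c) (star_graph 3))
         \<or> (a 1 = 1 \<and> a 2 = 1 \<and>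
            (\<exists>c c'. 1 \<le> c + 2 * c' \<and> c + 2 * c' \<le> A - t + 1 \<and>
              G \<simeq>\<^sub>g copies c (complete_graph 3) \<squnion>\<^sub>g copies c' (complete_graph 4)
                    \<squnion>\<^sub>g copies (A - t + 1 - c - 2 * c') (star_graph 3)))))"
proof -
  interpret star_ramsey t b
  proof
    show "b s \<ge> 1" if "s \<in> {1..t}" for s using assms(3) that by blast
  qed
  have a1: "s \<in> {1..t} \<Longrightarrow> a s \<ge> 1" for s using assms(2) by blast
  define n where "n = A - t + 1"
  have "(\<Sum>s=1..t. a s - 1) = A - t" using sum_subtractf_nat[of "{1..t}" "\<lambda>_. 1" a] a1 assms(5) by simp
  then have n: "n = (\<Sum>s=1..t. a s - 1) + 1" by (simp add: n_def)
  have "D = (\<Sum>s=1..t. b s) - t" unfolding D_def using sum_subtractf_nat[of "{1..t}" "\<lambda>_. 1" b] assms(3) by simp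
  then have B: "B = D + 1" using assms(6) by simp
  have G: "finite_simple_graph G" "arrows t G (\<lambda>s. copies (a s) (star_graph (b s)))"
    and cG: "card G = size_ramsey t (\<lambda>s. copies (a s) (star_graph (b s)))"
    using assms(7) by (auto simp: size_ramsey_minimal_def)
  \<comment> \<open>Disjoint stars bound the size from above and \<open>card_lower_bound\<close>
    bounds it from below, so \<open>G\<close> attains equality.\<close>
  have "card G \<le> n * (D + 1)" unfolding cG by (rule size_ramsey_le) (simp add: n)
  moreover have nk: "\<not> kill G (n - 1)" using kill_imp_not_arrows[OF G(1)] G(2) a1 n by auto
  have "(n - 1 + 1) * (D + 1) \<le> card G" by (rule card_lower_bound[OF G(1) nk])
  ultimately have card: "card G = n * (D + 1)" using n by simp
  then have "tight G n" using G(1) n nk by (simp add: tight_def)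
  then have "nice G" by (rule tight_imp_nice)
  then obtain d c c' k F1 F2 F3 F4 where P: "parts d c c' k F1 F2 F3 F4" and GF: "G = F1 \<union> F2 \<union> F3 \<union> F4"
    and cF: "card G = 4 * d + 3 * c + 6 * c' + (D + 1) * k" and big: "d + c' > 0 \<longrightarrow> big_component G"
    using nice_parts by blast
  note P' = P[unfolded parts_def]
  have iso: "F1 \<simeq>\<^sub>g copies d (cycle_graph 4)" "F2 \<simeq>\<^sub>g copies c (complete_graph 3)"
    "F3 \<simeq>\<^sub>g copies c' (complete_graph 4)" "F4 \<simeq>\<^sub>g copies k (star_graph (D + 1))"
    and dis: "\<Union>F1 \<inter> (\<Union>F2 \<union> \<Union>F3 \<union> \<Union>F4) = {}" "\<Union>F2 \<inter> (\<Union>F3 \<union> \<Union>F4) = {}" "\<Union>F3 \<inter> \<Union>F4 = {}"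
    and D1: "d > 0 \<Longrightarrow> D = 1" and exc: "c + c' > 0 \<Longrightarrow> exc"
    using P' by simp_all
  have F0: "d = 0 \<Longrightarrow> F1 = {}" "c = 0 \<Longrightarrow> F2 = {}" "c' = 0 \<Longrightarrow> F3 = {}"
    using iso(1-3) by (simp_all add: graph_iso_copies_0)
  have mult: "a r = 1" if "r \<in> {1..t}" "b r = 2" "d + c' > 0" for r
    using big_component_multiplicity[OF _ card n G(2) a1 that(1,2)] big that(3) by blast
  have exc2: "exc \<Longrightarrow> D = 2" by (simp add: exc_def)
  have t1: "1 \<in> {1..t}" using assms(1) by simp
  have sp1: "D = (b 1 - 1) + (\<Sum>s=2..t. b s - 1)"
    using sum.atLeast_Suc_atMost[OF assms(1), of "\<lambda>s. b s - 1"] by (simp add: D_def numeral_2_eq_2)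
  show ?thesis
  proof (cases "d > 0")
    case True
    then have D: "D = 1" by (rule D1)
    have "\<not> exc" using exc2 D by auto
    then have c0: "c = 0" "c' = 0" using exc by (metis add_gr_0 gr0I)+
    have b1: "b 1 \<ge> 2"
    \<comment> \<open>As \<open>b\<close> is non-increasing, \<open>b 1\<close> = 1 would make every
      excess vanish, contrary to \<open>D\<close> = 1.\<close>
    proof (rule ccontr)
      assume "\<not> 2 \<le> b 1"
      then have "b s - 1 = 0" if "s \<in> {1..t}" for s using assms(4) t1 that by fastforce
      then show False using D by (simp add: D_def)
    qed
    then have b12: "b 1 = 2" and z: "(\<Sum>s=2..t. b s - 1) = 0" using sp1 D by linarith+
    have "b s - 1 = 0" if "s \<in> {2..t}" for s using z that by simp
    then have bs: "\<forall>s\<in>{2..t}. b s = 1" using b_pos by fastforce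
    have k: "k = n - 2 * d" "1 \<le> d" "d \<le> n div 2" using cF card D c0 True by auto
    have "F1 \<union> F4 \<simeq>\<^sub>g copies d (cycle_graph 4) \<squnion>\<^sub>g copies k (star_graph (D + 1))"
      using dis by (intro graph_iso_disj_union[OF iso(1,4)]) auto
    then have "G \<simeq>\<^sub>g copies d (cycle_graph 4) \<squnion>\<^sub>g copies (n - 2 * d) (star_graph 2)"
      using GF F0 c0 k(1) D by (simp add: numeral_2_eq_2)
    moreover have "a 1 = 1" using mult[OF t1 b12] True by simp
    ultimately show ?thesis using b12 bs k unfolding n_def by blast
  next
    case False
    then have d0: "d = 0" "F1 = {}" using F0 by auto
    show ?thesis
    proof (cases "c + c' > 0")
      case False
      then have "n * (D + 1) = k * (D + 1)" using cF card d0 by (simp add: mult.commute)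
      then have "k = n" by (simp only: mult_cancel2) simp
      then have "G \<simeq>\<^sub>g copies n (star_graph B)" using False GF F0 d0 iso(4) B by simp
      then show ?thesis unfolding n_def by blast
    next
      case True
      then have exc: "exc" by (rule exc)
      then have D: "D = 2" using exc2 by blast
      obtain r s where rs: "r \<in> {1..t}" "s \<in> {1..t}" "r < s" "b r = 2" "b s = 2"
        using exc unfolding exc_def by (metis linorder_neqE_nat)
      then have t2: "t \<ge> 2" by simp
      have "2 \<in> {1..t}" using t2 by simp
      moreover have "1 \<le> r" "2 \<le> s" using rs by auto
      \<comment> \<open>The two colours given by \<open>exc\<close> may be any; monotonicity makes
        \<open>b 1\<close> and \<open>b 2\<close> at least 2, and the total excess 2 leaves nothing
        for later colours.\<close>
      ultimately have "b 1 \<ge> b r" "b 2 \<ge> b s" using assms(4) rs(1,2) t1 by blast+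
      moreover have "(\<Sum>s=2..t. b s - 1) = (b 2 - 1) + (\<Sum>s=3..t. b s - 1)"
        using sum.atLeast_Suc_atMost[OF t2, of "\<lambda>s. b s - 1"] by (simp add: numeral_3_eq_3 numeral_2_eq_2)
      ultimately have b2: "b 1 = 2" "b 2 = 2" and z: "(\<Sum>s=3..t. b s - 1) = 0" using sp1 D rs(4,5) by linarith+
      have "b s - 1 = 0" if "s \<in> {3..t}" for s using z that by simp
      then have bs: "\<forall>s\<in>{3..t}. b s = 1" using b_pos by fastforce
      have k: "n = c + 2 * c' + k" using cF card D d0 by simp
      have D3: "D + 1 = 3" using D by simp
      \<comment> \<open>Only a \<open>K_4\<close> component restricts \<open>a 1\<close> and
        \<open>a 2\<close>; triangles and stars alone give (2a).\<close>
      show ?thesis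
      proof (cases "c' = 0")
        case True
        have "F2 \<union> F4 \<simeq>\<^sub>g copies c (complete_graph 3) \<squnion>\<^sub>g copies k (star_graph (D + 1))"
          using dis by (intro graph_iso_disj_union[OF iso(2,4)]) auto
        moreover have "1 \<le> c" "c \<le> n" "k = n - c" using k True \<open>c + c' > 0\<close> by auto
        ultimately have "1 \<le> c \<and> c \<le> n \<and> G \<simeq>\<^sub>g copies c (complete_graph 3) \<squnion>\<^sub>g copies (n - c) (star_graph 3)"
          using GF F0 d0 True unfolding D3 by simp
        then show ?thesis using t2 b2 bs unfolding n_def by blast
      next
        case False
        have "F2 \<union> F3 \<union> F4 \<simeq>\<^sub>g copies c (complete_graph 3) \<squnion>\<^sub>g copies c' (complete_graph 4)
            \<squnion>\<^sub>g copies k (star_graph (D + 1))"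
          by (rule parts_iso[OF iso(2,3,4) dis(2,3)])
        moreover have "1 \<le> c + 2 * c'" "c + 2 * c' \<le> n" "k = n - c - 2 * c'" using k False by auto
        ultimately have "1 \<le> c + 2 * c' \<and> c + 2 * c' \<le> n \<and>
            G \<simeq>\<^sub>g copies c (complete_graph 3) \<squnion>\<^sub>g copies c' (complete_graph 4)
              \<squnion>\<^sub>g copies (n - c - 2 * c') (star_graph 3)"
          using GF d0 unfolding D3 by simp
        moreover have "a 1 = 1" "a 2 = 1" using mult[OF t1 b2(1)] mult[OF \<open>2 \<in> {1..t}\<close> b2(2)] False by auto
        ultimately show ?thesis using t2 b2 bs unfolding n_def by blast
      qed
    qed
  qed
qed

end
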